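(* Let $G$ be a free nilpotent Lie group of step at least $3$, with Lie algebra $\mathfrak g$ (identified with $G$ via the exponential map). Let $\mu$ be any non-centered probability measure on $G$, i.e. $\overline X_\mu:=\mathbb E(\mu_{ab})\neq0$, having finite second moment for the weight filtration induced by $\overline X_\mu$ and such that the support of $\mu_{ab}$ is not contained in a proper affine subspace of $\mathfrak g_{ab}$. Then the support of the limiting distribution $\nu=\lim_{N\to+\infty}D_{1/\sqrt N}(\mu^{*N}*\delta_{-NX_\mu})$ does not contain the identity in its interior.
   Context: A free nilpotent Lie group of step $s$ is the simply connected Lie group whose Lie algebra $\mathfrak g$ is a (finitely generated) free $s$-step nilpotent real Lie algebra. $\mathfrak g_{ab}:=\mathfrak g/[\mathfrak g,\mathfrak g]$; $\mu_{ab}$ is the image of $\mu$ in $\mathfrak g_{ab}$. The group product on $\mathfrak g$ is denoted $*$, as is convolution of measures; $\mu^{*N}*\delta_g$ is the law of $x*g$ for $x\sim\mu^{*N}$. The identity is $0\in\mathfrak g$. Weight filtration of $\mathfrak g$ induced by $\overline X_\mu$: $\mathfrak g^{(0)}=\mathfrak g^{(1)}=\mathfrak g$, $\mathfrak g^{(i+1)}=[\mathfrak g,\mathfrak g^{(i)}]+[x,\mathfrak g^{(i-1)}]$ for $i\ge1$, with $x\in\mathfrak g$ any representative of $\overline X_\mu$; $\mathfrak g^{(2)}=[\mathfrak g,\mathfrak g]$, $\mathfrak g^{(2s)}=0$. A weight decomposition is fixed: subspaces $\mathfrak m^{(i)}$, $1\le i\le 2s-1$, with $\mathfrak g^{(i)}=\mathfrak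 m^{(i)}\oplus\mathfrak g^{(i+1)}$, so $\mathfrak g=\bigoplus_i\mathfrak m^{(i)}$, with projections $x\mapsto x^{(i)}\in\mathfrak m^{(i)}$. $X_\mu$ is the representative of $\overline X_\mu$ in $\mathfrak m^{(1)}$. $D_r(x)=\sum_ir^ix^{(i)}$, and $D_r(\eta)$ is the push-forward of a measure $\eta$ by $D_r$. $\mu$ has finite second moment for the weight filtration if $\int\|y^{(i)}\|^{2/i}d\mu(y)<\infty$ for each $i$. Under these assumptions the weak limit $\nu$ exists and is a probability measure with smooth density (central limit theorem). It is also the law at time $1$ of the diffusion started at $0$ on $\mathfrak g$ with generator $\mathscr L_t=\frac12\sum_{i}(\exp(ta_{X_\mu})E_i)^2+\exp(ta_{X_\mu})B_\mu$, where: vectors are viewed as left-invariant vector fields for the Lie group product $*'$ on $\mathfrak g$ associated to the bracket $[x,y]'=\pi^{(i+j)}([x,y])$ ($x\in\mathfrak m^{(i)},y\in\mathfrak m^{(j)}$, $\pi^{(k)}$ the projection to $\mathfrak m^{(k)}$); $a_{X_\mu}(y)=\pi^{(i+2)}([X_\mu,y])$ for $y\in\mathfrak m^{(i)}$; $(E_i)$ is a basis of $\mathfrak m^{(1)}$ in which $\pi^{(1)}(\mu)$ has identity covariance matrix; $B_\mu=\mathbb E_\mu(x^{(2)})$. *)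

theory Defs
  imports "HOL-Probability.Probability" "HOL-Analysis.Finite_Function_Topology"
begin

text \<open>A Lie algebra is given by a bracket on the whole of a real vector space type.\<close>

definition lie_algebra :: "('a::real_vector \<Rightarrow> 'a \<Rightarrow> 'a) \<Rightarrow> bool" where
  "lie_algebra br \<longleftrightarrow> bilinear br \<and> (\<forall>x. br x x = 0) \<and>
     (\<forall>x y z. br x (br y z) + br y (br z x) + br z (br x y) = 0)"

definition lie_hom :: "('a::real_vector \<Rightarrow> 'a \<Rightarrow> 'a) \<Rightarrow> ('b::real_vector \<Rightarrow> 'b \<Rightarrow> 'b) \<Rightarrow> ('a \<Rightarrow> 'b) \<Rightarrow> bool" where
  "lie_hom br br' \<phi> \<longleftrightarrow> linear \<phi> \<and> (\<forall>x y. \<phi> (br x y) = br' (\<phi> x) (\<phi> y))"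

definition bracket_span :: "('a::real_vector \<Rightarrow> 'a \<Rightarrow> 'a) \<Rightarrow> 'a set \<Rightarrow> 'a set \<Rightarrow> 'a set" where
  "bracket_span br V W = span {br v w | v w. v \<in> V \<and> w \<in> W}"

definition subspace_sum :: "'a::real_vector set \<Rightarrow> 'a set \<Rightarrow> 'a set" where
  "subspace_sum V W = {v + w | v w. v \<in> V \<and> w \<in> W}"

text \<open>The index is shifted by one: \<open>lower_central br k\<close> is spanned by the brackets of
  length \<open>k + 1\<close>.\<close>

primrec lower_central :: "('a::real_vector \<Rightarrow> 'a \<Rightarrow> 'a) \<Rightarrow> nat \<Rightarrow> 'a set" where
  "lower_central br 0 = UNIV"
| "lower_central br (Suc k) = bracket_span br UNIV (lower_central br k)"

text \<open>\<open>B\<close> is a free generating set within the \<open>s\<close>-step nilpotent Lie algebras (step at most \<open>s\<close>).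
  The universal property is tested on all such Lie algebra structures on the vector space
  \<open>nat \<Rightarrow>\<^sub>0 real\<close> of countable dimension. For finite \<open>B\<close> this is the universal property for
  all targets: a finitely generated Lie algebra has countable dimension, so after adding an
  abelian summand it is isomorphic to one on this space.\<close>

definition freely_generates :: "('a::real_vector \<Rightarrow> 'a \<Rightarrow> 'a) \<Rightarrow> nat \<Rightarrow> 'a set \<Rightarrow> bool" where
  "freely_generates br s B \<longleftrightarrow>
     (\<forall>br' :: (nat \<Rightarrow>\<^sub>0 real) \<Rightarrow> (nat \<Rightarrow>\<^sub>0 real) \<Rightarrow> (nat \<Rightarrow>\<^sub>0 real).
        lie_algebra br' \<and> lower_central br' s = {0} \<longrightarrow>
        (\<forall>f. \<exists>!\<phi>. lie_hom br br' \<phi> \<and> (\<forall>b\<in>B. \<phi> b = f b)))"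

text \<open>The step is exactly \<open>s\<close>; for \<open>s \<ge> 2\<close> this excludes the free algebras on fewer than two
  generators, which are abelian.\<close>

definition free_nilpotent_lie_algebra :: "('a::real_vector \<Rightarrow> 'a \<Rightarrow> 'a) \<Rightarrow> nat \<Rightarrow> bool" where
  "free_nilpotent_lie_algebra br s \<longleftrightarrow>
     lie_algebra br \<and> lower_central br s = {0} \<and> (\<forall>k<s. lower_central br k \<noteq> {0}) \<and>
     (\<exists>B. finite B \<and> freely_generates br s B)"

text \<open>\<open>ab\<close> is a realization of the quotient map onto \<open>\<gg> / [\<gg>, \<gg>]\<close>.\<close>

definition abelianization_map :: "('a::real_vector \<Rightarrow> 'a \<Rightarrow> 'a) \<Rightarrow> ('a \<Rightarrow> 'b::real_vector) \<Rightarrow> bool" where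
  "abelianization_map br ab \<longleftrightarrow>
     linear ab \<and> surj ab \<and> {x. ab x = 0} = bracket_span br UNIV UNIV"

text \<open>The group law in exponential coordinates, by Dynkin's form of the Baker-Campbell-Hausdorff
  series
  \[ \sum_{n \geq 1} \frac{(-1)^{n-1}}{n} \sum_{p_i + q_i > 0}
     \frac{[x^{p_1} y^{q_1} \cdots x^{p_n} y^{q_n}]}{\sum_i (p_i + q_i) \prod_i p_i! q_i!} \]
  with right-nested brackets. In a Lie algebra of step at most \<open>s\<close> the terms with more than
  \<open>s\<close> letters vanish, which leaves a finite sum.\<close>

fun nested_bracket :: "('a::real_vector \<Rightarrow> 'a \<Rightarrow> 'a) \<Rightarrow> 'a list \<Rightarrow> 'a" where
  "nested_bracket br [] = 0"
| "nested_bracket br [x] = x"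
| "nested_bracket br (x # y # zs) = br x (nested_bracket br (y # zs))"

definition bch_degree :: "(nat \<times> nat) list \<Rightarrow> nat" where
  "bch_degree ps = (\<Sum>(p, q)\<leftarrow>ps. p + q)"

definition bch_word :: "(nat \<times> nat) list \<Rightarrow> 'a \<Rightarrow> 'a \<Rightarrow> 'a list" where
  "bch_word ps x y = concat (map (\<lambda>(p, q). replicate p x @ replicate q y) ps)"

definition bch_indices :: "nat \<Rightarrow> (nat \<times> nat) list set" where
  "bch_indices s = {ps. ps \<noteq> [] \<and> (\<forall>(p, q)\<in>set ps. 0 < p + q) \<and> bch_degree ps \<le> s}"

definition bch_coeff :: "(nat \<times> nat) list \<Rightarrow> real" where
  "bch_coeff ps = (- 1) ^ (length ps - 1) /
     (real (length ps) * real (bch_degree ps) * (\<Prod>(p, q)\<leftarrow>ps. fact p * fact q))"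

definition group_mult :: "('a::real_vector \<Rightarrow> 'a \<Rightarrow> 'a) \<Rightarrow> nat \<Rightarrow> 'a \<Rightarrow> 'a \<Rightarrow> 'a" where
  "group_mult br s x y =
     (\<Sum>ps\<in>bch_indices s. bch_coeff ps *\<^sub>R nested_bracket br (bch_word ps x y))"

lemma length_le_bch_degree:
  assumes "\<forall>(p, q)\<in>set ps. 0 < p + q"
  shows "length ps \<le> bch_degree ps"
  using assms by (induction ps) (auto simp: bch_degree_def)

lemma bch_degree_ge: "(p, q) \<in> set ps \<Longrightarrow> p + q \<le> bch_degree ps"
  by (induction ps) (auto simp: bch_degree_def)

lemma finite_bch_indices: "finite (bch_indices s)"
proof (rule finite_subset)
  show "bch_indices s \<subseteq> {ps. set ps \<subseteq> {..s} \<times> {..s} \<and> length ps \<le> s}"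
    using length_le_bch_degree bch_degree_ge
    by (fastforce simp: bch_indices_def intro: order_trans)
  show "finite {ps. set ps \<subseteq> {..s} \<times> {..s} \<and> length ps \<le> s}"
    by (rule finite_lists_length_le) auto
qed

text \<open>The weight filtration \<open>\<gg>\<^sup>(\<^sup>i\<^sup>)\<close> for a representative \<open>x\<close> of the mean.\<close>

fun weight_filtration :: "('a::real_vector \<Rightarrow> 'a \<Rightarrow> 'a) \<Rightarrow> 'a \<Rightarrow> nat \<Rightarrow> 'a set" where
  "weight_filtration br x 0 = UNIV"
| "weight_filtration br x (Suc 0) = UNIV"
| "weight_filtration br x (Suc (Suc i)) =
     subspace_sum (bracket_span br UNIV (weight_filtration br x (Suc i)))
                  (bracket_span br {x} (weight_filtration br x i))"

definition weight_decomposition ::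
    "('a::real_vector \<Rightarrow> 'a \<Rightarrow> 'a) \<Rightarrow> nat \<Rightarrow> 'a \<Rightarrow> (nat \<Rightarrow> 'a set) \<Rightarrow> bool" where
  "weight_decomposition br s x m \<longleftrightarrow>
     (\<forall>i\<in>{1..2 * s - 1}. subspace (m i) \<and>
        m i \<inter> weight_filtration br x (i + 1) = {0} \<and>
        subspace_sum (m i) (weight_filtration br x (i + 1)) = weight_filtration br x i)"

definition weight_comp :: "nat \<Rightarrow> (nat \<Rightarrow> 'a::real_vector set) \<Rightarrow> nat \<Rightarrow> 'a \<Rightarrow> 'a" where
  "weight_comp s m i x =
     (THE u. (\<forall>j\<in>{1..2 * s - 1}. u j \<in> m j) \<and> (\<forall>j. j \<notin> {1..2 * s - 1} \<longrightarrow> u j = 0) \<and>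
             x = (\<Sum>j = 1..2 * s - 1. u j)) i"

definition dilation :: "nat \<Rightarrow> (nat \<Rightarrow> 'a::real_vector set) \<Rightarrow> real \<Rightarrow> 'a \<Rightarrow> 'a" where
  "dilation s m r x = (\<Sum>i = 1..2 * s - 1. r ^ i *\<^sub>R weight_comp s m i x)"

definition finite_weighted_second_moment ::
    "nat \<Rightarrow> (nat \<Rightarrow> 'a::euclidean_space set) \<Rightarrow> 'a measure \<Rightarrow> bool" where
  "finite_weighted_second_moment s m \<mu> \<longleftrightarrow>
     (\<forall>i\<in>{1..2 * s - 1}. integrable \<mu> (\<lambda>y. norm (weight_comp s m i y) powr (2 / real i)))"

definition group_convolution ::
    "('a::euclidean_space \<Rightarrow> 'a \<Rightarrow> 'a) \<Rightarrow> nat \<Rightarrow> 'a measure \<Rightarrow> 'a measure \<Rightarrow> 'a measure" where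
  "group_convolution br s \<mu> \<eta> = distr (\<mu> \<Otimes>\<^sub>M \<eta>) borel (\<lambda>(x, y). group_mult br s x y)"

primrec convolution_power ::
    "('a::euclidean_space \<Rightarrow> 'a \<Rightarrow> 'a) \<Rightarrow> nat \<Rightarrow> 'a measure \<Rightarrow> nat \<Rightarrow> 'a measure" where
  "convolution_power br s \<mu> 0 = return borel 0"
| "convolution_power br s \<mu> (Suc N) = group_convolution br s (convolution_power br s \<mu> N) \<mu>"

definition weakly_converges_to :: "(nat \<Rightarrow> 'a::topological_space measure) \<Rightarrow> 'a measure \<Rightarrow> bool" where
  "weakly_converges_to M \<nu> \<longleftrightarrow>
     (\<forall>f :: 'a \<Rightarrow> real. continuous_on UNIV f \<and> bounded (range f) \<longrightarrow>
        (\<lambda>N. \<integral>x. f x \<partial>M N) \<longlonglongrightarrow> (\<integral>x. f x \<partial>\<nu>))"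

definition measure_support :: "'a::topological_space measure \<Rightarrow> 'a set" where
  "measure_support M = {x. \<forall>U. open U \<and> x \<in> U \<longrightarrow> emeasure M U > 0}"

end

theory Submission
  imports Defs
begin

text \<open>Let \<open>A(t)\<close> be the image of the limiting Brownian motion under a linear functional that vanishes on
the drift direction \<open>X\<close> and takes the value 1 at some \<open>Y\<close>. The coordinate of the limit along
\<open>[Y, [Y, X]]\<close> sees the quantity \<open>\<integral> A(t)\<^sup>2 dt\<close>, and a square integral cannot be negative. This gives a
polynomial inequality on the support of the limit which is an equality at the identity and fails
at points arbitrarily close to it.

To make this precise, freeness provides a homomorphism from \<open>\<gg>\<close> onto the filiform Lie algebra with
basis \<open>e\<^sub>0\<close>, \<open>e\<^sub>1\<close>, \<open>e\<^sub>2 = [e\<^sub>1, e\<^sub>0]\<close>, \<open>e\<^sub>3 = [e\<^sub>1, e\<^sub>2]\<close>, all other brackets of basis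
vectors being zero, that sends \<open>X\<close> to \<open>e\<^sub>0\<close> (\<open>free_nilpotent_filiform_coordinates\<close>); this needs
step at least 3. Write \<open>f0\<close>, \<open>f1\<close>, \<open>f2\<close>, \<open>f3\<close> for its coordinates. Let \<open>W\<close> be the coefficient of
the word \<open>e\<^sub>1 e\<^sub>1 e\<^sub>0\<close> in the exponential series of an element. Since coefficients of words multiply
by splitting the word, \<open>W\<close> of the random walk \<open>x\<^sub>1 * \<dots> * x\<^sub>N\<close> is
\[ \sum_k \left( \frac{A_k^2}{2} f_0(x_{k+1}) + A_k\, t(x_{k+1}) + W(x_{k+1}) \right),
   \qquad A_k = \sum_{i \leq k} f_1(x_i), \]
where \<open>t\<close> is the coefficient of \<open>e\<^sub>1 e\<^sub>0\<close> (\<open>partial_product_filiform\<close>). As \<open>f0\<close> has mean 1, the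
first summand contributes \<open>\<Sum> A\<^sub>k\<^sup>2 / 2\<close>, which is nonnegative; under the weighted moment assumption
everything else is \<open>o(N\<^sup>2)\<close> in probability. Hence \<open>W\<close> of the walk exceeds \<open>- \<epsilon> N\<^sup>2\<close> with probability
tending to 1 (\<open>walk_functional_lower_bound\<close>).

Multiplication by \<open>exp (- N X)\<close> subtracts \<open>N A\<^sub>N\<^sup>2 / 2\<close> from \<open>W\<close>, and the dilation by \<open>1 / \<surd>N\<close>
turns \<open>(W + N f\<^sub>1\<^sup>2 / 2) / N\<^sup>2\<close> into a fixed polynomial \<open>limit_form\<close>, up to an error of order
\<open>1 / \<surd>N\<close> on bounded sets (\<open>word110_rescaled\<close>). So \<open>limit_form\<close> is nonnegative on the support of
the limit (\<open>limit_form_nonneg_on_support\<close>). But it vanishes at \<open>0\<close> and equals \<open>- c\<close> at \<open>- c a\<close>,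
where \<open>a\<close> is the component of \<open>[Y, [Y, X]]\<close> in \<open>\<mm>\<^sup>(\<^sup>4\<^sup>)\<close> (\<open>limit_form_negative_near_0\<close>).\<close>

section \<open>A filiform quotient of the free nilpotent Lie algebra\<close>

lemma lookup_scaleR:
  "Poly_Mapping.lookup (r *\<^sub>R x) i = r * Poly_Mapping.lookup (x :: nat \<Rightarrow>\<^sub>0 real) i"
proof -
  have "finite {i. r *\<^sub>R Poly_Mapping.lookup x i \<noteq> 0}"
    by (rule finite_subset[OF _ finite_lookup[of x]]) auto
  then show ?thesis
    by (simp add: scaleR_poly_mapping_def)
qed

text \<open>The filiform Lie algebra with basis \<open>e\<^sub>0, \<dots>, e\<^sub>3\<close>, placed on the first four coordinates of a
space of countable dimension, the remaining coordinates being central. The universal property of a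
free generating set speaks about Lie algebras on this space.\<close>

definition filiform_bracket :: "(nat \<Rightarrow>\<^sub>0 real) \<Rightarrow> (nat \<Rightarrow>\<^sub>0 real) \<Rightarrow> (nat \<Rightarrow>\<^sub>0 real)" where
  "filiform_bracket x y =
     (let c = Poly_Mapping.lookup in
        Poly_Mapping.single 2 (c x 1 * c y 0 - c x 0 * c y 1) +
        Poly_Mapping.single 3 (c x 1 * c y 2 - c x 2 * c y 1))"

lemma lookup_filiform_bracket:
  "Poly_Mapping.lookup (filiform_bracket x y) i =
     (if i = 2 then Poly_Mapping.lookup x 1 * Poly_Mapping.lookup y 0
                  - Poly_Mapping.lookup x 0 * Poly_Mapping.lookup y 1
      else if i = 3 then Poly_Mapping.lookup x 1 * Poly_Mapping.lookup y 2
                  - Poly_Mapping.lookup x 2 * Poly_Mapping.lookup y 1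
      else 0)"
  by (simp add: filiform_bracket_def Let_def lookup_add lookup_single when_def)

lemma lie_algebra_filiform_bracket: "lie_algebra filiform_bracket"
  unfolding lie_algebra_def bilinear_def
  by (auto intro!: linearI poly_mapping_eqI
      simp: lookup_filiform_bracket lookup_add lookup_scaleR algebra_simps)

lemma lie_algebra_zero_right: "lie_algebra br \<Longrightarrow> br x 0 = 0"
  unfolding lie_algebra_def bilinear_def by (blast intro: linear_0)

lemma lower_central_eq_zero_mono:
  assumes "lie_algebra br" "lower_central br k = {0}" "k \<le> l"
  shows "lower_central br l = {0}"
  using assms(3)
proof (induction l rule: dec_induct)
  case (step l)
  then show ?case
    using assms(1) by (simp add: bracket_span_def lie_algebra_zero_right)
qed (use assms in simp)

lemma subspace_bracket_span: "subspace (bracket_span br V W)"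
  by (simp add: bracket_span_def)

lemma subspace_lower_central: "subspace (lower_central br k)"
  by (cases k) (auto simp: subspace_bracket_span)

lemma bracket_in_bracket_span: "v \<in> V \<Longrightarrow> w \<in> W \<Longrightarrow> br v w \<in> bracket_span br V W"
  unfolding bracket_span_def by (rule span_base) blast

lemma bracket_span_least:
  assumes "subspace U" and "\<And>v w. v \<in> V \<Longrightarrow> w \<in> W \<Longrightarrow> br v w \<in> U"
  shows "bracket_span br V W \<subseteq> U"
  unfolding bracket_span_def by (rule span_minimal) (use assms in auto)

lemma bracket_span_mono: "V \<subseteq> V' \<Longrightarrow> W \<subseteq> W' \<Longrightarrow> bracket_span br V W \<subseteq> bracket_span br V' W'"
  unfolding bracket_span_def by (rule span_mono) blast

text \<open>The derived algebra lies in the span of \<open>e\<^sub>2\<close> and \<open>e\<^sub>3\<close>, the next term in that of \<open>e\<^sub>3\<close>, and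
\<open>e\<^sub>3\<close> is central.\<close>

lemma lower_central_filiform_bracket:
  assumes "3 \<le> s"
  shows "lower_central filiform_bracket s = {0}"
proof (rule lower_central_eq_zero_mono[OF lie_algebra_filiform_bracket _ assms])
  let ?c = "Poly_Mapping.lookup"
  let ?U = "\<lambda>n. {z :: nat \<Rightarrow>\<^sub>0 real. \<forall>i<n. ?c z i = 0}"
  have sub: "subspace (?U n)" for n
    by (auto simp: subspace_def lookup_add lookup_scaleR)
  have 1: "lower_central filiform_bracket 1 \<subseteq> ?U 2"
    by (simp, intro bracket_span_least sub) (auto simp: lookup_filiform_bracket)
  have 2: "lower_central filiform_bracket (Suc 1) \<subseteq> ?U 3"
    using 1 by (subst lower_central.simps, intro bracket_span_least sub)
      (auto simp: lookup_filiform_bracket subset_iff)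
  have 3: "lower_central filiform_bracket (Suc (Suc 1)) \<subseteq> {0}"
    using 2 by (subst lower_central.simps, intro bracket_span_least)
      (auto intro!: poly_mapping_eqI simp: lookup_filiform_bracket subset_iff)
  moreover have "3 = Suc (Suc 1)" by simp
  ultimately show "lower_central filiform_bracket 3 = {0}"
    using subspace_0[OF subspace_lower_central, of filiform_bracket 3] by (metis subset_singletonD empty_iff)
qed

text \<open>The four functions are the coordinates of a Lie algebra homomorphism to the filiform algebra.\<close>

definition filiform_coordinates ::
    "('a::real_vector \<Rightarrow> 'a \<Rightarrow> 'a) \<Rightarrow> ('a \<Rightarrow> real) \<Rightarrow> ('a \<Rightarrow> real) \<Rightarrow> ('a \<Rightarrow> real) \<Rightarrow> ('a \<Rightarrow> real) \<Rightarrow> bool" where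
  "filiform_coordinates br f0 f1 f2 f3 \<longleftrightarrow>
     linear f0 \<and> linear f1 \<and> linear f2 \<and> linear f3 \<and>
     (\<forall>x y. f0 (br x y) = 0 \<and> f1 (br x y) = 0 \<and>
        f2 (br x y) = f1 x * f0 y - f0 x * f1 y \<and>
        f3 (br x y) = f1 x * f2 y - f2 x * f1 y)"

lemma freely_generates_ex1:
  fixes br' :: "(nat \<Rightarrow>\<^sub>0 real) \<Rightarrow> (nat \<Rightarrow>\<^sub>0 real) \<Rightarrow> (nat \<Rightarrow>\<^sub>0 real)"
  assumes "freely_generates br s B" and "lie_algebra br'" and "lower_central br' s = {0}"
  shows "\<exists>!\<phi>. lie_hom br br' \<phi> \<and> (\<forall>b\<in>B. \<phi> b = f b)"
  using assms unfolding freely_generates_def by simp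

text \<open>A functional that kills all brackets is a homomorphism to an abelian Lie algebra, so the
uniqueness part of the universal property applies to it.\<close>

lemma freely_generates_functional_unique:
  assumes free: "freely_generates br s B" and "1 \<le> s"
    and f: "linear f" "\<And>x y. f (br x y) = 0" and g: "linear g" "\<And>x y. g (br x y) = 0"
    and eq: "\<And>b. b \<in> B \<Longrightarrow> f b = (g b :: real)"
  shows "f = g"
proof -
  let ?zero = "\<lambda>x y. 0 :: nat \<Rightarrow>\<^sub>0 real"
  define inj where "inj h x = Poly_Mapping.single (0::nat) (h x)" for h :: "'a \<Rightarrow> real" and x
  have zero: "lie_algebra ?zero"
    by (auto simp: lie_algebra_def bilinear_def intro!: linearI)
  have "lower_central ?zero 1 = {0}"
    by (simp add: bracket_span_def)
  from lower_central_eq_zero_mono[OF zero this \<open>1 \<le> s\<close>] have "lower_central ?zero s = {0}" .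
  note unique = freely_generates_ex1[OF free zero this, of "inj f"]
  have hom: "lie_hom br ?zero (inj h)" if "linear h" "\<And>x y. h (br x y) = 0" for h
    unfolding lie_hom_def inj_def
    by (auto simp: lookup_add lookup_single lookup_scaleR when_def that(2)
        linear_add[OF that(1)] linear_scale[OF that(1)] intro!: linearI poly_mapping_eqI)
  have "\<forall>b\<in>B. inj g b = inj f b"
    using eq by (simp add: inj_def)
  then have "inj f = inj g"
    using unique hom[OF f] hom[OF g] by blast
  then have "Poly_Mapping.lookup (inj f x) 0 = Poly_Mapping.lookup (inj g x) 0" for x
    by simp
  then show ?thesis
    by (simp add: inj_def fun_eq_iff)
qed

text \<open>Extend \<open>b \<mapsto> f0 b e\<^sub>0 + f1 b e\<^sub>1\<close> from the generators to a homomorphism. Its first two coordinates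
kill brackets and agree with the given functionals on the generators, hence everywhere. This way
the functionals can be prescribed on the whole algebra, without reference to the generators.\<close>

lemma freely_generates_filiform_coordinates:
  assumes free: "freely_generates br s B" and "3 \<le> s"
    and f0: "linear f0" "\<And>x y. f0 (br x y) = 0" and f1: "linear f1" "\<And>x y. f1 (br x y) = 0"
  obtains f2 f3 where "filiform_coordinates br f0 f1 f2 f3"
proof -
  let ?c = "Poly_Mapping.lookup"
  obtain \<phi> where hom: "lie_hom br filiform_bracket \<phi>"
    and \<phi>: "\<And>b. b \<in> B \<Longrightarrow> \<phi> b = Poly_Mapping.single 0 (f0 b) + Poly_Mapping.single 1 (f1 b)"
    using freely_generates_ex1[OF free lie_algebra_filiform_bracket
        lower_central_filiform_bracket[OF \<open>3 \<le> s\<close>],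
        of "\<lambda>b. Poly_Mapping.single 0 (f0 b) + Poly_Mapping.single 1 (f1 b)"]
    by blast
  have lin: "linear (\<lambda>x. ?c (\<phi> x) i)" for i
  proof -
    have "linear \<phi>" using hom by (simp add: lie_hom_def)
    then show ?thesis
      by (intro linearI) (simp_all add: linear_add[of \<phi>] linear_scale[of \<phi>] lookup_add lookup_scaleR)
  qed
  have br: "?c (\<phi> (br x y)) i = ?c (filiform_bracket (\<phi> x) (\<phi> y)) i" for x y i
    using hom by (simp add: lie_hom_def)
  have 0: "f0 = (\<lambda>x. ?c (\<phi> x) 0)"
    by (rule freely_generates_functional_unique[OF free])
      (use \<open>3 \<le> s\<close> in \<open>simp_all add: f0 lin br lookup_filiform_bracket \<phi> lookup_add lookup_single\<close>)
  have 1: "f1 = (\<lambda>x. ?c (\<phi> x) 1)"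
    by (rule freely_generates_functional_unique[OF free])
      (use \<open>3 \<le> s\<close> in \<open>simp_all add: f1 lin[of 1, simplified] br lookup_filiform_bracket \<phi> lookup_add lookup_single\<close>)
  show thesis
  proof
    show "filiform_coordinates br f0 f1 (\<lambda>x. ?c (\<phi> x) 2) (\<lambda>x. ?c (\<phi> x) 3)"
      unfolding filiform_coordinates_def 0 1 by (simp add: lin lin[of 1, simplified] br lookup_filiform_bracket)
  qed
qed

text \<open>The new functions are the coordinates with respect to the basis \<open>e\<^sub>0 + p e\<^sub>2 + q e\<^sub>3\<close>, \<open>e\<^sub>1\<close>,
\<open>e\<^sub>2 + p e\<^sub>3\<close>, \<open>e\<^sub>3\<close>, which satisfies the same bracket relations. An element with coordinates
\<open>(1, 0, p, q)\<close> thus becomes the first basis vector.\<close>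

lemma filiform_coordinates_normalize:
  assumes "filiform_coordinates br f0 f1 f2 f3"
  shows "filiform_coordinates br f0 f1 (\<lambda>x. f2 x - p * f0 x) (\<lambda>x. f3 x - q * f0 x - p * (f2 x - p * f0 x))"
proof -
  have lin: "linear f0" "linear f1" "linear f2" "linear f3"
    and br: "\<And>x y. f0 (br x y) = 0" "\<And>x y. f1 (br x y) = 0"
      "\<And>x y. f2 (br x y) = f1 x * f0 y - f0 x * f1 y" "\<And>x y. f3 (br x y) = f1 x * f2 y - f2 x * f1 y"
    using assms by (auto simp: filiform_coordinates_def)
  show ?thesis
    unfolding filiform_coordinates_def br
    by (auto simp: lin[THEN linear_add] lin[THEN linear_scale] algebra_simps intro!: linearI)
qed

text \<open>If \<open>\<gg>\<close> is spanned by one element modulo \<open>[\<gg>, \<gg>]\<close>, then \<open>[\<gg>, \<gg>] = [\<gg>, [\<gg>, \<gg>]]\<close>, because the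
bracket of that element with itself vanishes; nilpotency then forces \<open>[\<gg>, \<gg>] = 0\<close>.\<close>

lemma lower_central_1_eq_zero:
  assumes lie: "lie_algebra br" and nil: "lower_central br s = {0}" and "1 \<le> s"
    and span: "span (insert X (lower_central br 1)) = UNIV"
  shows "lower_central br 1 = {0}"
proof -
  have bil: "bilinear br" and alt: "\<And>x. br x x = 0"
    using lie by (auto simp: lie_algebra_def)
  have anti: "br x y = - br y x" for x y
  proof -
    have "br (x + y) (x + y) = br x x + br y x + (br x y + br y y)"
      by (simp only: bilinear_ladd[OF bil] bilinear_radd[OF bil])
    then have "br x y + br y x = 0"
      by (simp add: alt add.commute)
    then show ?thesis by (simp add: eq_neg_iff_add_eq_0)
  qed
  let ?D = "lower_central br 1"
  have eq1: "?D = bracket_span br UNIV UNIV" by simp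
  have dec: "\<exists>c d. d \<in> ?D \<and> v = c *\<^sub>R X + d" for v
  proof -
    have "v \<in> span (insert X ?D)" by (simp only: span UNIV_I)
    then obtain c where "v - c *\<^sub>R X \<in> span ?D" by (auto simp: span_insert)
    then have "v - c *\<^sub>R X \<in> ?D" using subspace_lower_central span_eq_iff by blast
    then show ?thesis by (intro exI[of _ c] exI[of _ "v - c *\<^sub>R X"]) auto
  qed
  \<comment> \<open>With \<open>v = c X + d\<close> and \<open>w = c' X + d'\<close> the bracket \<open>[v, w]\<close>
    loses its term \<open>[X, X] = 0\<close>, and every other term contains \<open>d\<close> or \<open>d'\<close>.\<close>
  have step: "?D \<subseteq> lower_central br 2"
    unfolding eq1
  proof (rule bracket_span_least)
    fix v w
    obtain c d where v: "d \<in> ?D" "v = c *\<^sub>R X + d" using dec by blast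
    obtain c' d' where w: "d' \<in> ?D" "w = c' *\<^sub>R X + d'" using dec by blast
    have in2: "br u z \<in> lower_central br 2" if "z \<in> ?D" for u z
      using that by (auto simp: numeral_2_eq_2 intro!: bracket_in_bracket_span)
    have "br v w = br v d' + c' *\<^sub>R br d X"
      unfolding v w by (simp add: bilinear_ladd[OF bil] bilinear_radd[OF bil] bilinear_lmul[OF bil]
          bilinear_rmul[OF bil] alt)
    also have "\<dots> = br v d' - c' *\<^sub>R br X d"
      using anti[of d X] by simp
    also have "\<dots> \<in> lower_central br 2"
      using in2 v w by (intro subspace_diff subspace_scale subspace_lower_central) auto
    finally show "br v w \<in> lower_central br 2" .
  qed (rule subspace_lower_central)
  have "?D \<subseteq> lower_central br s"
    using \<open>1 \<le> s\<close>
  proof (induction s rule: dec_induct)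
    case (step n)
    have "?D \<subseteq> bracket_span br UNIV ?D" using \<open>?D \<subseteq> lower_central br 2\<close> by (simp add: numeral_2_eq_2)
    also have "\<dots> \<subseteq> lower_central br (Suc n)"
      unfolding lower_central.simps(2) using step.IH by (intro bracket_span_mono) simp_all
    finally show ?case .
  qed simp
  then show ?thesis
    using nil subspace_0[OF subspace_lower_central] by blast
qed

text \<open>Since the algebra is not abelian, some functional \<open>f1\<close> is nonzero and kills both \<open>X\<close> and all
brackets. The functional \<open>f0\<close> is the normalized inner product with the part of \<open>X\<close> orthogonal to
the derived algebra. The element \<open>Y\<close> certifies that \<open>f1\<close> does not vanish.\<close>

lemma free_nilpotent_filiform_coordinates:
  fixes br :: "'a::euclidean_space \<Rightarrow> 'a \<Rightarrow> 'a"
  assumes free: "free_nilpotent_lie_algebra br s" and "3 \<le> s" and X: "X \<notin> bracket_span br UNIV UNIV"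
  obtains f0 f1 f2 f3 Y where "filiform_coordinates br f0 f1 f2 f3"
    and "f0 X = 1" "f1 X = 0" "f2 X = 0" "f3 X = 0" and "f1 Y = 1"
proof -
  let ?D = "bracket_span br UNIV UNIV"
  obtain B where lie: "lie_algebra br" and nil: "lower_central br s = {0}"
    and gen: "freely_generates br s B" and step: "\<And>k. k < s \<Longrightarrow> lower_central br k \<noteq> {0}"
    using free unfolding free_nilpotent_lie_algebra_def by auto
  have "lower_central br 1 \<noteq> {0}"
    using step[of 1] \<open>3 \<le> s\<close> by linarith
  then have "span (insert X ?D) \<noteq> UNIV"
    using lower_central_1_eq_zero[OF lie nil, of X] \<open>3 \<le> s\<close> by auto
  then obtain Z where Z: "Z \<noteq> 0" "\<And>v. v \<in> span (insert X ?D) \<Longrightarrow> Z \<bullet> v = 0"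
    using span_not_UNIV_orthogonal by blast
  obtain u W where W: "u \<in> span ?D" "\<And>w. w \<in> span ?D \<Longrightarrow> orthogonal W w" "X = u + W"
    using orthogonal_subspace_decomp_exists[of ?D X] by metis
  have "W \<noteq> 0" using X W by (metis add.right_neutral span_eq_iff subspace_bracket_span)
  define f0 where "f0 v = (W \<bullet> v) / (W \<bullet> W)" for v
  define f1 where "f1 v = (Z \<bullet> v) / (Z \<bullet> Z)" for v
  have "br x y \<in> span ?D" "br x y \<in> span (insert X ?D)" for x y
    by (intro span_base insertI2 bracket_in_bracket_span; simp)+
  then have "f0 (br x y) = 0" "f1 (br x y) = 0" for x y
    using W(2) Z(2) by (auto simp: f0_def f1_def orthogonal_def)
  moreover have "linear f0" "linear f1"
    unfolding f0_def f1_def by (auto intro!: linearI simp: inner_add_right add_divide_distrib)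
  ultimately obtain f2 f3 where f: "filiform_coordinates br f0 f1 f2 f3"
    using freely_generates_filiform_coordinates[OF gen \<open>3 \<le> s\<close>] by blast
  have "W \<bullet> X = W \<bullet> W"
    using W by (simp add: inner_add_right orthogonal_def)
  moreover have "Z \<bullet> X = 0"
    using Z(2) by (simp add: span_base)
  ultimately have "f0 X = 1" "f1 X = 0" "f1 Z = 1"
    using Z(1) \<open>W \<noteq> 0\<close> by (simp_all add: f0_def f1_def)
  then show thesis
    using that[OF filiform_coordinates_normalize[OF f, of "f2 X" "f3 X"], of Z] by simp
qed

section \<open>The group law in filiform coordinates\<close>

lemma bch_degree_Cons: "bch_degree ((p, q) # ps) = p + q + bch_degree ps"
  by (simp add: bch_degree_def)

lemma length_bch_word: "length (bch_word ps x y) = bch_degree ps"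
  by (induction ps) (auto simp: bch_word_def bch_degree_def)

text \<open>The index lists of the Baker-Campbell-Hausdorff series of one fixed degree; grouped by degree they
can be enumerated recursively by their first entry.\<close>

definition bch_compositions :: "nat \<Rightarrow> (nat \<times> nat) list set" where
  "bch_compositions n = {ps. (\<forall>(p, q)\<in>set ps. 0 < p + q) \<and> bch_degree ps = n}"

lemma bch_compositions_0: "bch_compositions 0 = {[]}"
proof -
  have "ps = []" if "\<forall>(p, q)\<in>set ps. 0 < p + q" "bch_degree ps = 0" for ps
    using length_le_bch_degree[OF that(1)] that(2) by simp
  then show ?thesis
    by (auto simp: bch_compositions_def bch_degree_def)
qed

lemma bch_compositions_Suc:
  "bch_compositions (Suc n) =
     (\<Union>k\<le>n. \<Union>p\<le>Suc k. (#) (p, Suc k - p) ` bch_compositions (n - k))"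
proof (intro equalityI subsetI)
  fix ps assume ps: "ps \<in> bch_compositions (Suc n)"
  then obtain p q qs where qs: "ps = (p, q) # qs"
    by (cases ps) (auto simp: bch_compositions_def bch_degree_def)
  have "0 < p + q" "p + q + bch_degree qs = Suc n" "\<forall>(p, q)\<in>set qs. 0 < p + q"
    using ps by (auto simp: qs bch_compositions_def bch_degree_Cons)
  then have "p + q - 1 \<le> n" "p \<le> Suc (p + q - 1)" "q = Suc (p + q - 1) - p"
     "qs \<in> bch_compositions (n - (p + q - 1))"
    by (auto simp: bch_compositions_def)
  then show "ps \<in> (\<Union>k\<le>n. \<Union>p\<le>Suc k. (#) (p, Suc k - p) ` bch_compositions (n - k))"
    unfolding qs by blast
qed (auto simp: bch_compositions_def bch_degree_Cons)

lemma bch_indices_3: "bch_indices 3 = bch_compositions 1 \<union> bch_compositions 2 \<union> bch_compositions 3"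
proof (rule set_eqI)
  fix ps
  have nonempty: "ps \<noteq> [] \<longleftrightarrow> bch_degree ps \<noteq> 0" if "\<forall>(p, q)\<in>set ps. 0 < p + q"
    using length_le_bch_degree[OF that] that by (cases ps) (auto simp: bch_degree_def)
  have "n \<noteq> 0 \<and> n \<le> 3 \<longleftrightarrow> n = 1 \<or> n = 2 \<or> n = 3" for n :: nat by arith
  then show "ps \<in> bch_indices 3 \<longleftrightarrow> ps \<in> bch_compositions 1 \<union> bch_compositions 2 \<union> bch_compositions 3"
    unfolding bch_indices_def bch_compositions_def Un_iff mem_Collect_eq using nonempty by metis
qed

text \<open>The 33 terms of the series with at most three letters.\<close>

definition bch_list_3 :: "(nat \<times> nat) list list" where
  "bch_list_3 =
    [[(1,0)], [(0,1)],
     [(2,0)], [(1,1)], [(0,2)],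
     [(1,0),(1,0)], [(1,0),(0,1)], [(0,1),(1,0)], [(0,1),(0,1)],
     [(3,0)], [(2,1)], [(1,2)], [(0,3)],
     [(1,0),(2,0)], [(1,0),(1,1)], [(1,0),(0,2)], [(0,1),(2,0)], [(0,1),(1,1)], [(0,1),(0,2)],
     [(2,0),(1,0)], [(1,1),(1,0)], [(0,2),(1,0)], [(2,0),(0,1)], [(1,1),(0,1)], [(0,2),(0,1)],
     [(1,0),(1,0),(1,0)], [(1,0),(1,0),(0,1)], [(1,0),(0,1),(1,0)], [(1,0),(0,1),(0,1)],
     [(0,1),(1,0),(1,0)], [(0,1),(1,0),(0,1)], [(0,1),(0,1),(1,0)], [(0,1),(0,1),(0,1)]]"

lemma distinct_bch_list_3: "distinct bch_list_3"
  by (simp add: bch_list_3_def)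

lemma bch_indices_3_explicit: "bch_indices 3 = set bch_list_3"
  unfolding bch_list_3_def bch_indices_3
  by (simp add: numeral_eq_Suc bch_compositions_Suc bch_compositions_0 atMost_Suc image_Un
      insert_commute)

text \<open>In the filiform algebra all brackets of more than three letters vanish, so that the series reduces
to its terms of degree at most 3. Evaluating these gives the familiar
\<open>x + y + [x, y] / 2 + [x, [x, y]] / 12 + [y, [y, x]] / 12\<close>.\<close>

lemma filiform_group_mult:
  assumes f: "filiform_coordinates br f0 f1 f2 f3" and s: "3 \<le> s"
  shows "f0 (group_mult br s x y) = f0 x + f0 y"
    and "f1 (group_mult br s x y) = f1 x + f1 y"
    and "f2 (group_mult br s x y) = f2 x + f2 y + (f1 x * f0 y - f0 x * f1 y) / 2"
    and "f3 (group_mult br s x y) = f3 x + f3 y + (f1 x * f2 y - f2 x * f1 y) / 2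
           + (f1 x - f1 y) * (f1 x * f0 y - f0 x * f1 y) / 12"
proof -
  have lin: "linear f0" "linear f1" "linear f2" "linear f3"
    and br: "\<And>x y. f0 (br x y) = 0" "\<And>x y. f1 (br x y) = 0"
      "\<And>x y. f2 (br x y) = f1 x * f0 y - f0 x * f1 y" "\<And>x y. f3 (br x y) = f1 x * f2 y - f2 x * f1 y"
    using f by (auto simp: filiform_coordinates_def)
  have long: "g (nested_bracket br w) = 0"
    if g: "g \<in> {f0, f1, f2, f3}" and len: "3 < length w" for w g
  proof -
    obtain a b c d r where "w = a # b # c # d # r"
      using len by (auto simp: numeral_eq_Suc Suc_less_eq2 length_Suc_conv neq_Nil_conv)
    then show ?thesis using g by (auto simp: br)
  qed
  have red: "g (group_mult br s x y) =
      (\<Sum>ps\<in>bch_indices 3. bch_coeff ps * g (nested_bracket br (bch_word ps x y)))"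
    if g: "g \<in> {f0, f1, f2, f3}" for g
  proof -
    have "linear g" using g lin by auto
    then have "g (group_mult br s x y) =
      (\<Sum>ps\<in>bch_indices s. bch_coeff ps * g (nested_bracket br (bch_word ps x y)))"
      by (simp add: group_mult_def linear_sum linear_scale)
    also have "\<dots> = (\<Sum>ps\<in>bch_indices 3. bch_coeff ps * g (nested_bracket br (bch_word ps x y)))"
    proof (rule sum.mono_neutral_right[OF finite_bch_indices])
      show "bch_indices 3 \<subseteq> bch_indices s"
        using s by (auto simp: bch_indices_def)
    qed (auto simp: bch_indices_def length_bch_word intro!: long[OF g])
    finally show ?thesis .
  qed
  have sum: "(\<Sum>ps\<in>bch_indices 3. h ps) = sum_list (map h bch_list_3)" for h :: "(nat \<times> nat) list \<Rightarrow> real"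
    unfolding bch_indices_3_explicit using distinct_bch_list_3 by (rule sum.distinct_set_conv_list)
  note evaluate = bch_list_3_def bch_coeff_def bch_word_def bch_degree_def numeral_eq_Suc
  show "f0 (group_mult br s x y) = f0 x + f0 y"
    by (subst red, simp, subst sum, simp add: evaluate br)
  show "f1 (group_mult br s x y) = f1 x + f1 y"
    by (subst red, simp, subst sum, simp add: evaluate br)
  show "f2 (group_mult br s x y) = f2 x + f2 y + (f1 x * f0 y - f0 x * f1 y) / 2"
    by (subst red, simp, subst sum, simp add: evaluate br, simp add: field_simps)
  show "f3 (group_mult br s x y) = f3 x + f3 y + (f1 x * f2 y - f2 x * f1 y) / 2
           + (f1 x - f1 y) * (f1 x * f0 y - f0 x * f1 y) / 12"
    by (subst red, simp, subst sum, simp add: evaluate br, simp add: field_simps)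
qed

text \<open>The coefficient of the word \<open>e\<^sub>1 e\<^sub>0\<close> in the exponential of \<open>f0 x e\<^sub>0 + \<dots> + f3 x e\<^sub>3\<close> within the
tensor algebra on \<open>e\<^sub>0\<close> and \<open>e\<^sub>1\<close>.\<close>

definition word10 :: "('a \<Rightarrow> real) \<Rightarrow> ('a \<Rightarrow> real) \<Rightarrow> ('a \<Rightarrow> real) \<Rightarrow> 'a \<Rightarrow> real" where
  "word10 f0 f1 f2 x = f2 x + f0 x * f1 x / 2"

text \<open>Similarly, the coefficient of the word \<open>e\<^sub>1 e\<^sub>1 e\<^sub>0\<close>.\<close>

definition word110 :: "('a \<Rightarrow> real) \<Rightarrow> ('a \<Rightarrow> real) \<Rightarrow> ('a \<Rightarrow> real) \<Rightarrow> ('a \<Rightarrow> real) \<Rightarrow> 'a \<Rightarrow> real" where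
  "word110 f0 f1 f2 f3 x = f3 x + f1 x * f2 x / 2 + (f1 x)\<^sup>2 * f0 x / 6"

text \<open>The word \<open>e\<^sub>1 e\<^sub>1 e\<^sub>0\<close> is split between the two factors in all four ways. The coefficient of
\<open>e\<^sub>1 e\<^sub>1\<close> in an exponential is half the square of that of \<open>e\<^sub>1\<close>.\<close>

lemma word110_group_mult:
  assumes "filiform_coordinates br f0 f1 f2 f3" "3 \<le> s"
  shows "word110 f0 f1 f2 f3 (group_mult br s x y) =
    word110 f0 f1 f2 f3 x + (f1 x)\<^sup>2 / 2 * f0 y + f1 x * word10 f0 f1 f2 y + word110 f0 f1 f2 f3 y"
  unfolding word110_def word10_def filiform_group_mult[OF assms]
  by (simp add: field_simps power2_eq_square)

section \<open>The weight decomposition\<close>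

lemma subspace_subspace_sum: "subspace V \<Longrightarrow> subspace W \<Longrightarrow> subspace (subspace_sum V W)"
  unfolding subspace_sum_def by (rule subspace_sums)

lemma subspace_sum_least: "subspace U \<Longrightarrow> V \<subseteq> U \<Longrightarrow> W \<subseteq> U \<Longrightarrow> subspace_sum V W \<subseteq> U"
  unfolding subspace_sum_def by (auto intro: subspace_add)

lemma subspace_weight_filtration: "subspace (weight_filtration br x i)"
  by (induction br x i rule: weight_filtration.induct)
    (auto intro: subspace_subspace_sum subspace_bracket_span)

lemma lower_central_decseq:
  assumes "k \<le> l"
  shows "lower_central br l \<subseteq> lower_central br k"
proof -
  have "lower_central br (Suc k) \<subseteq> lower_central br k" for k
  proof (induction k)
    case (Suc k)
    then show ?case
      unfolding lower_central.simps(2)[of _ "Suc k"] by (subst lower_central.simps(2)[of _ k]) (rule bracket_span_mono[OF order_refl])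
  qed simp
  then show ?thesis using assms by (rule lift_Suc_antimono_le)
qed

lemma weight_filtration_least:
  assumes "subspace U" "\<And>v w. w \<in> weight_filtration br x (Suc i) \<Longrightarrow> br v w \<in> U"
    and "\<And>w. w \<in> weight_filtration br x i \<Longrightarrow> br x w \<in> U"
  shows "weight_filtration br x (Suc (Suc i)) \<subseteq> U"
  unfolding weight_filtration.simps using assms
  by (intro subspace_sum_least bracket_span_least) auto

lemma bracket_in_weight_filtration:
  assumes "w \<in> weight_filtration br x (Suc i)"
  shows "br v w \<in> weight_filtration br x (Suc (Suc i))"
proof -
  have "br v w + 0 \<in> weight_filtration br x (Suc (Suc i))"
    unfolding weight_filtration.simps subspace_sum_def using assms
    by (blast intro: bracket_in_bracket_span subspace_0[OF subspace_bracket_span])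
  then show ?thesis by simp
qed

lemma bracket_mean_in_weight_filtration:
  assumes "w \<in> weight_filtration br x i"
  shows "br x w \<in> weight_filtration br x (Suc (Suc i))"
proof -
  have "0 + br x w \<in> weight_filtration br x (Suc (Suc i))"
    unfolding weight_filtration.simps subspace_sum_def using assms
    by (blast intro: bracket_in_bracket_span subspace_0[OF subspace_bracket_span])
  then show ?thesis by simp
qed

text \<open>Each bracket raises the weight by at most 2. Therefore the weight filtration of an algebra of step
\<open>s\<close> ends at the index \<open>2 s\<close>.\<close>

lemma weight_filtration_subset_lower_central: "weight_filtration br x i \<subseteq> lower_central br (i div 2)"
proof (induction br x i rule: weight_filtration.induct)
  case (3 br x i)
  have "weight_filtration br x (Suc (Suc i)) \<subseteq> lower_central br (Suc (i div 2))"
  proof (rule weight_filtration_least[OF subspace_lower_central])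
    show "br v w \<in> lower_central br (Suc (i div 2))" if "w \<in> weight_filtration br x (Suc i)" for v w
    proof -
      have "i div 2 \<le> Suc i div 2" by (rule div_le_mono) simp
      then have "w \<in> lower_central br (i div 2)"
        using that 3(1) lower_central_decseq by blast
      then show ?thesis by (auto intro: bracket_in_bracket_span)
    qed
    show "br x w \<in> lower_central br (Suc (i div 2))" if "w \<in> weight_filtration br x i" for w
      using that 3(2) by (auto intro!: bracket_in_bracket_span)
  qed
  then show ?case by simp
qed auto

text \<open>Complements of the successive terms of a filtration that ends at \<open>0\<close> add up to a direct sum
decomposition. The locale derives this for the weight filtration, together with linearity of the
component maps.\<close>

locale graded_complements =
  fixes br :: "'a::real_vector \<Rightarrow> 'a \<Rightarrow> 'a" and s :: nat and X :: 'a and m :: "nat \<Rightarrow> 'a set"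
  assumes nilpotent: "lower_central br s = {0}" and step_pos: "1 \<le> s"
    and decomposition: "weight_decomposition br s X m"
begin

abbreviation G :: "nat \<Rightarrow> 'a set" where "G \<equiv> weight_filtration br X"
abbreviation n :: nat where "n \<equiv> 2 * s - 1"
abbreviation proj :: "nat \<Rightarrow> 'a \<Rightarrow> 'a" where "proj \<equiv> weight_comp s m"

lemma G_top: "G (Suc n) = {0}"
proof -
  have "Suc n = 2 * s" using step_pos by simp
  then show ?thesis
    using weight_filtration_subset_lower_central[of br X "2 * s"] nilpotent
      subspace_0[OF subspace_weight_filtration, of br X "2 * s"] by auto
qed

lemma m_facts:
  assumes "i \<in> {1..n}"
  shows "subspace (m i)" "m i \<inter> G (Suc i) = {0}" "subspace_sum (m i) (G (Suc i)) = G i"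
  using decomposition assms by (auto simp: weight_decomposition_def)

lemma m_subset_G: "i \<in> {1..n} \<Longrightarrow> m i \<subseteq> G i"
  using m_facts(3)[of i] subspace_0[OF subspace_weight_filtration, of br X "Suc i"]
  by (force simp: subspace_sum_def)

lemma G_Suc_subset: "i \<in> {1..n} \<Longrightarrow> G (Suc i) \<subseteq> G i"
  using m_facts(3)[of i] subspace_0[OF m_facts(1), of i] by (force simp: subspace_sum_def)

lemma G_antimono:
  assumes "1 \<le> i" "i \<le> j" "j \<le> Suc n"
  shows "G j \<subseteq> G i"
  using assms(2,3)
proof (induction j rule: dec_induct)
  case (step j)
  then have "j \<le> Suc n" "j \<in> {1..n}" using \<open>1 \<le> i\<close> by auto
  then show ?case using step.IH G_Suc_subset by blast
qed simp

definition components :: "(nat \<Rightarrow> 'a) \<Rightarrow> bool" where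
  "components u \<longleftrightarrow> (\<forall>j\<in>{1..n}. u j \<in> m j) \<and> (\<forall>j. j \<notin> {1..n} \<longrightarrow> u j = 0)"

lemma components_exist_from:
  assumes "1 \<le> i" "i \<le> Suc n"
  shows "x \<in> G i \<Longrightarrow> \<exists>u. components u \<and> x = (\<Sum>j = i..n. u j)"
  using assms(2,1)
proof (induction i arbitrary: x rule: inc_induct)
  case base
  have "components (\<lambda>_. 0)"
    using m_facts(1) by (auto simp: components_def intro: subspace_0)
  then show ?case using base G_top by auto
next
  case (step i)
  then have i: "i \<in> {1..n}" by auto
  have "x \<in> subspace_sum (m i) (G (Suc i))"
    using step.prems unfolding m_facts(3)[OF i] by blast
  then obtain v w where v: "v \<in> m i" and w: "w \<in> G (Suc i)" and x: "x = v + w"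
    unfolding subspace_sum_def by blast
  obtain u where u: "components u" "w = (\<Sum>j = Suc i..n. u j)"
    using step.IH[OF w] by auto
  have "components (u(i := v))"
    using u(1) v i by (auto simp: components_def)
  moreover have "x = (\<Sum>j = i..n. (u(i := v)) j)"
    using i by (simp add: x u(2) sum.atLeast_Suc_atMost)
  ultimately show ?case by blast
qed

text \<open>The first component that is not yet known to vanish is minus the sum of the later ones, so it lies
in the next term of the filtration, which meets the complement only in \<open>0\<close>.\<close>

lemma components_zero:
  assumes u: "components u" and sum: "(\<Sum>j = 1..n. u j) = 0"
  shows "u = (\<lambda>_. 0)"
proof -
  have "u k = 0" for k
  proof (induction k rule: less_induct)
    case (less k)
    show ?case
    proof (cases "k \<in> {1..n}")
      case k: True
      have "(\<Sum>j = 1..n. u j) = (\<Sum>j = k..n. u j)"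
        using k less by (intro sum.mono_neutral_right) auto
      also have "\<dots> = u k + (\<Sum>j = Suc k..n. u j)"
        using k by (simp add: sum.atLeast_Suc_atMost)
      finally have "u k = - (\<Sum>j = Suc k..n. u j)"
        using sum by (simp add: eq_neg_iff_add_eq_0)
      also have "\<dots> \<in> G (Suc k)"
      proof (intro subspace_neg subspace_sum subspace_weight_filtration)
        fix j assume j: "j \<in> {Suc k..n}"
        then have "u j \<in> G j" using u m_subset_G[of j] by (auto simp: components_def)
        then show "u j \<in> G (Suc k)" using j G_antimono[of "Suc k" j] by auto
      qed
      finally show ?thesis
        using u k m_facts(2)[OF k] by (auto simp: components_def)
    qed (use u in \<open>auto simp: components_def\<close>)
  qed
  then show ?thesis by auto
qed

lemma components_unique:
  assumes "components u" "components v" "(\<Sum>j = 1..n. u j) = (\<Sum>j = 1..n. v j)"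
  shows "u = v"
proof -
  have "components (\<lambda>j. u j - v j)"
    using assms(1,2) m_facts(1) by (auto simp: components_def intro!: subspace_diff)
  moreover have "(\<Sum>j = 1..n. u j - v j) = 0"
    using assms(3) by (simp add: sum_subtractf)
  ultimately have "(\<lambda>j. u j - v j) = (\<lambda>_. 0)" by (rule components_zero)
  then show ?thesis by (simp add: fun_eq_iff)
qed

lemma proj_eqI:
  assumes "components u" "x = (\<Sum>j = 1..n. u j)"
  shows "proj i x = u i"
proof -
  have "(THE u. components u \<and> x = (\<Sum>j = 1..n. u j)) = u"
    using assms components_unique by (intro the_equality) auto
  then show ?thesis
    unfolding weight_comp_def components_def by (simp add: conj_assoc)
qed

lemma components_proj: "components (\<lambda>j. proj j x)" and sum_proj: "x = (\<Sum>j = 1..n. proj j x)"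
proof -
  obtain u where u: "components u" "x = (\<Sum>j = 1..n. u j)"
    using components_exist_from[of 1 x] by auto
  then have eq: "proj j x = u j" for j by (rule proj_eqI)
  show "components (\<lambda>j. proj j x)" "x = (\<Sum>j = 1..n. proj j x)"
    unfolding eq by (rule u)+
qed

lemma proj_in_m: "j \<in> {1..n} \<Longrightarrow> proj j x \<in> m j"
  using components_proj[of x] by (auto simp: components_def)

lemma linear_proj: "linear (proj i)"
proof (rule linearI)
  fix x y r
  show "proj i (x + y) = proj i x + proj i y"
  proof (rule proj_eqI)
    show "components (\<lambda>j. proj j x + proj j y)"
      using components_proj[of x] components_proj[of y] m_facts(1)
      by (auto simp: components_def intro: subspace_add)
    show "x + y = (\<Sum>j = 1..n. proj j x + proj j y)"
      by (simp only: sum.distrib sum_proj[symmetric])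
  qed
  show "proj i (r *\<^sub>R x) = r *\<^sub>R proj i x"
  proof (rule proj_eqI)
    show "components (\<lambda>j. r *\<^sub>R proj j x)"
      using components_proj[of x] m_facts(1) by (auto simp: components_def intro: subspace_scale)
    show "r *\<^sub>R x = (\<Sum>j = 1..n. r *\<^sub>R proj j x)"
      by (simp only: scaleR_sum_right[symmetric] sum_proj[symmetric])
  qed
qed

lemma proj_dilation: "proj i (dilation s m r x) = r ^ i *\<^sub>R proj i x"
  by (rule proj_eqI[of "\<lambda>j. r ^ j *\<^sub>R proj j x"])
    (use components_proj[of x] m_facts(1) in
      \<open>auto simp: components_def dilation_def intro: subspace_scale\<close>)

lemma proj_of_m:
  assumes "k \<in> {1..n}" "x \<in> m k"
  shows "proj i x = (if i = k then x else 0)"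
  by (rule proj_eqI[of "\<lambda>j. if j = k then x else 0"])
    (use assms m_facts(1) in \<open>auto simp: components_def intro: subspace_0\<close>)

text \<open>A functional that vanishes on the filtration beyond weight \<open>k\<close> only sees the components of weight
at most \<open>k\<close>. It may well be nonzero on components of smaller weight, since the complements are
arbitrary; dilation makes those contributions negligible.\<close>

lemma functional_eq_sum_proj:
  assumes f: "linear f" and vanish: "\<And>x. x \<in> G (Suc k) \<Longrightarrow> f x = 0" and "k \<le> n"
  shows "f x = (\<Sum>i = 1..k. f (proj i x))"
proof -
  have "f x = (\<Sum>i = 1..n. f (proj i x))"
    using arg_cong[OF sum_proj[of x], of f] by (simp add: linear_sum[OF f])
  also have "\<dots> = (\<Sum>i = 1..k. f (proj i x))"
  proof (rule sum.mono_neutral_right)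
    show "\<forall>i\<in>{1..n} - {1..k}. f (proj i x) = 0"
    proof
      fix i assume i: "i \<in> {1..n} - {1..k}"
      then have "proj i x \<in> G i" using proj_in_m m_subset_G by blast
      moreover have "G i \<subseteq> G (Suc k)"
        using i by (intro G_antimono) auto
      ultimately show "f (proj i x) = 0" using vanish by blast
    qed
  qed (use \<open>k \<le> n\<close> in auto)
  finally show ?thesis .
qed

end

section \<open>Fractional moments\<close>

text \<open>After division by \<open>x + y\<close> the summands lie in \<open>[0, 1]\<close>, where \<open>t \<le> t\<^sup>p\<close>.\<close>

lemma powr_add_le_add_powr:
  fixes x y p :: real
  assumes "0 \<le> x" "0 \<le> y" "0 < p" "p \<le> 1"
  shows "(x + y) powr p \<le> x powr p + y powr p"
proof (cases "x + y = 0")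
  case False
  define z where "z = x + y"
  have z: "0 < z" using False assms by (simp add: z_def)
  have *: "u / z \<le> (u / z) powr p" if "0 \<le> u" "u \<le> z" for u
    using powr_mono'[of p 1 "u / z"] that z assms by simp
  have "1 = x / z + y / z"
    using z by (simp add: z_def flip: add_divide_distrib)
  also have "\<dots> \<le> (x / z) powr p + (y / z) powr p"
    using assms by (intro add_mono *) (auto simp: z_def)
  also have "\<dots> = (x powr p + y powr p) / z powr p"
    using z assms by (simp add: powr_divide add_divide_distrib)
  finally show ?thesis
    using z by (simp add: z_def field_simps)
qed (use assms in simp)

lemma powr_sum_le_sum_powr:
  fixes x :: "'i \<Rightarrow> real"
  assumes "\<And>i. i \<in> I \<Longrightarrow> 0 \<le> x i" "0 < p" "p \<le> 1"
  shows "(\<Sum>i\<in>I. x i) powr p \<le> (\<Sum>i\<in>I. x i powr p)"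
  using assms(1)
proof (induction I rule: infinite_finite_induct)
  case (insert i I)
  have "(\<Sum>i\<in>insert i I. x i) powr p \<le> x i powr p + (\<Sum>i\<in>I. x i) powr p"
    using insert.hyps insert.prems assms(2,3) by (auto intro!: powr_add_le_add_powr sum_nonneg)
  also have "\<dots> \<le> x i powr p + (\<Sum>i\<in>I. x i powr p)"
    using insert.IH insert.prems by simp
  finally show ?case using insert.hyps by simp
qed (use assms in auto)

definition finite_moment :: "'a measure \<Rightarrow> real \<Rightarrow> ('a \<Rightarrow> real) \<Rightarrow> bool" where
  "finite_moment M p f \<longleftrightarrow> f \<in> borel_measurable M \<and> integrable M (\<lambda>x. \<bar>f x\<bar> powr p)"

lemma finite_moment_bounded:
  assumes g: "g \<in> borel_measurable M" and int: "integrable M h"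
    and bound: "\<And>x. \<bar>g x\<bar> powr p \<le> h x"
  shows "finite_moment M p g"
proof -
  have "0 \<le> h x" for x using bound[of x] powr_ge_zero[of "\<bar>g x\<bar>" p] by linarith
  then have "integrable M (\<lambda>x. \<bar>g x\<bar> powr p)"
    using g bound by (intro Bochner_Integration.integrable_bound[OF int]) auto
  with g show ?thesis by (simp add: finite_moment_def)
qed

lemma finite_moment_add:
  assumes "finite_moment M p f" "finite_moment M p g" "0 < p" "p \<le> 1"
  shows "finite_moment M p (\<lambda>x. f x + g x)"
proof (rule finite_moment_bounded)
  show "integrable M (\<lambda>x. \<bar>f x\<bar> powr p + \<bar>g x\<bar> powr p)"
    using assms by (simp add: finite_moment_def)
  show "\<bar>f x + g x\<bar> powr p \<le> \<bar>f x\<bar> powr p + \<bar>g x\<bar> powr p" for x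
    using assms(3,4) by (intro order_trans[OF powr_mono2 powr_add_le_add_powr]) auto
qed (use assms in \<open>auto simp: finite_moment_def\<close>)

lemma finite_moment_cmult:
  assumes "finite_moment M p f"
  shows "finite_moment M p (\<lambda>x. c * f x)"
  using assms by (auto simp: finite_moment_def abs_mult powr_mult)

lemma finite_moment_le:
  assumes "finite_measure M" "finite_moment M q f" "0 < p" "p \<le> q"
  shows "finite_moment M p f"
proof (rule finite_moment_bounded)
  interpret finite_measure M by fact
  show "integrable M (\<lambda>x. 1 + \<bar>f x\<bar> powr q)"
    using assms by (simp add: finite_moment_def)
  show "\<bar>f x\<bar> powr p \<le> 1 + \<bar>f x\<bar> powr q" for x
  proof (cases "\<bar>f x\<bar> \<le> 1")
    case True
    then have "\<bar>f x\<bar> powr p \<le> 1" using assms(3) by (simp add: powr_le1)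
    then show ?thesis using powr_ge_zero[of "\<bar>f x\<bar>" q] by linarith
  next
    case False
    then have "\<bar>f x\<bar> powr p \<le> \<bar>f x\<bar> powr q" using assms(4) by (intro powr_mono) auto
    then show ?thesis by linarith
  qed
qed (use assms in \<open>auto simp: finite_moment_def\<close>)

text \<open>Hoelder's inequality in a crude form: \<open>r / p\<close> and \<open>r / q\<close> add up to 1, so
\<open>u powr (r / p) * v powr (r / q)\<close> is at most the larger of \<open>u\<close> and \<open>v\<close>, for
\<open>u = \<bar>f x\<bar> powr p\<close> and \<open>v = \<bar>g x\<bar> powr q\<close>.\<close>

lemma finite_moment_mult:
  assumes f: "finite_moment M p f" and g: "finite_moment M q g" and pq: "0 < p" "0 < q"
    and r: "r = p * q / (p + q)"
  shows "finite_moment M r (\<lambda>x. f x * g x)"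
proof (rule finite_moment_bounded)
  show "integrable M (\<lambda>x. \<bar>f x\<bar> powr p + \<bar>g x\<bar> powr q)"
    using assms by (simp add: finite_moment_def)
  show "\<bar>f x * g x\<bar> powr r \<le> \<bar>f x\<bar> powr p + \<bar>g x\<bar> powr q" for x
  proof -
    define u v where "u = \<bar>f x\<bar> powr p" and "v = \<bar>g x\<bar> powr q"
    have "0 \<le> u" "0 \<le> v" by (simp_all add: u_def v_def)
    have rp: "p * (r / p) = r" "q * (r / q) = r" "r / p + r / q = 1" "0 < r"
    proof -
      have "r / p = q / (p + q)" "r / q = p / (p + q)" using pq by (simp_all add: r)
      then show "r / p + r / q = 1" using pq by (simp add: add_divide_distrib[symmetric] add.commute)
    qed (use pq in \<open>simp_all add: r\<close>)
    have "\<bar>f x * g x\<bar> powr r = u powr (r / p) * v powr (r / q)"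
      using rp by (simp add: abs_mult powr_mult u_def v_def powr_powr)
    also have "\<dots> \<le> max u v powr (r / p) * max u v powr (r / q)"
      using \<open>0 \<le> u\<close> \<open>0 \<le> v\<close> pq rp by (intro mult_mono powr_mono2) auto
    also have "\<dots> = max u v"
      using rp \<open>0 \<le> u\<close> by (simp add: powr_add[symmetric])
    also have "\<dots> \<le> u + v" using \<open>0 \<le> u\<close> \<open>0 \<le> v\<close> by simp
    finally show ?thesis by (simp add: u_def v_def)
  qed
qed (use assms in \<open>auto simp: finite_moment_def\<close>)

lemma finite_moment_2_iff: "finite_moment M 2 f \<longleftrightarrow> f \<in> borel_measurable M \<and> integrable M (\<lambda>x. (f x)\<^sup>2)"
  by (simp add: finite_moment_def powr_numeral)

lemma linear_borel_measurable:
  fixes f :: "'a::euclidean_space \<Rightarrow> 'b::euclidean_space"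
  shows "linear f \<Longrightarrow> f \<in> borel_measurable borel"
  by (intro borel_measurable_continuous_onI linear_continuous_on) (simp add: linear_conv_bounded_linear)

section \<open>Functionals of independent sequences\<close>

lemma (in prob_space) sequence_spaceI: "sequence_space M"
  by (simp add: sequence_space_def prob_space_axioms product_prob_spaceI)

lemma (in sequence_space) measurable_coordinate [measurable]: "(\<lambda>\<omega>. \<omega> k) \<in> measurable S M"
  by (rule measurable_component_singleton) simp

lemma (in sequence_space) distr_coordinate: "distr S M (\<lambda>\<omega>. \<omega> k) = M"
  using PiM_component[of k] by simp

text \<open>The whole sequence has the law of a sequence that is spliced at \<open>k\<close> from two independent copies.
After splicing, \<open>F\<close> depends on the first copy and the \<open>k\<close>-th entry comes from the second one.\<close>

lemma (in sequence_space) distr_past_present: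
  assumes F [measurable]: "F \<in> measurable S T" and g [measurable]: "g \<in> measurable M T'"
    and past: "\<And>\<omega> \<omega>'. (\<And>i. i < k \<Longrightarrow> \<omega> i = \<omega>' i) \<Longrightarrow> F \<omega> = F \<omega>'"
  shows "distr S (T \<Otimes>\<^sub>M T') (\<lambda>\<omega>. (F \<omega>, g (\<omega> k))) = distr S T F \<Otimes>\<^sub>M distr M T' g"
proof -
  have marginal: "distr S T' (\<lambda>\<omega>. g (\<omega> 0)) = distr M T' g"
    using distr_distr[of g M T' "\<lambda>\<omega>. \<omega> 0" S] by (simp add: distr_coordinate comp_def)
  interpret M: prob_space M by (rule prob_space)
  interpret T': prob_space "distr M T' g" by (rule M.prob_space_distr) fact
  have "distr S (T \<Otimes>\<^sub>M T') (\<lambda>\<omega>. (F \<omega>, g (\<omega> k))) =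
      distr (distr (S \<Otimes>\<^sub>M S) S (\<lambda>(\<omega>, \<omega>'). comb_seq k \<omega> \<omega>')) (T \<Otimes>\<^sub>M T') (\<lambda>\<omega>. (F \<omega>, g (\<omega> k)))"
    by (simp only: PiM_comb_seq)
  also have "\<dots> = distr (S \<Otimes>\<^sub>M S) (T \<Otimes>\<^sub>M T') (\<lambda>(\<omega>, \<omega>'). (F \<omega>, g (\<omega>' 0)))"
  proof (subst distr_distr)
    have "F (comb_seq k \<omega> \<omega>') = F \<omega>" for \<omega> \<omega>'
      by (rule past) (simp add: comb_seq_less)
    moreover have "comb_seq k \<omega> \<omega>' k = \<omega>' 0" for \<omega> \<omega>' :: "nat \<Rightarrow> 'a"
      by (simp add: comb_seq_def)
    ultimately show "distr (S \<Otimes>\<^sub>M S) (T \<Otimes>\<^sub>M T') ((\<lambda>\<omega>. (F \<omega>, g (\<omega> k))) \<circ> (\<lambda>(\<omega>, \<omega>'). comb_seq k \<omega> \<omega>')) =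
        distr (S \<Otimes>\<^sub>M S) (T \<Otimes>\<^sub>M T') (\<lambda>(\<omega>, \<omega>'). (F \<omega>, g (\<omega>' 0)))"
      by (simp add: comp_def case_prod_unfold)
  qed simp_all
  also have "\<dots> = distr S T F \<Otimes>\<^sub>M distr S T' (\<lambda>\<omega>. g (\<omega> 0))"
    by (rule pair_measure_distr[symmetric]) (auto simp: marginal T'.sigma_finite_measure_axioms)
  finally show ?thesis by (simp add: marginal)
qed

lemma (in sequence_space) indep_past_present:
  assumes F [measurable]: "F \<in> borel_measurable S" and g [measurable]: "g \<in> borel_measurable M"
    and past: "\<And>\<omega> \<omega>'. (\<And>i. i < k \<Longrightarrow> \<omega> i = \<omega>' i) \<Longrightarrow> F \<omega> = F \<omega>'"
  shows "indep_var borel F borel (\<lambda>\<omega>. g (\<omega> k))"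
proof -
  have "distr S borel (\<lambda>\<omega>. g (\<omega> k)) = distr M borel g"
    using distr_distr[of g M borel "\<lambda>\<omega>. \<omega> k" S] by (simp add: distr_coordinate comp_def)
  then show ?thesis
    using distr_past_present[OF F g past, of k] by (simp add: indep_var_distribution_eq)
qed

lemma (in sequence_space) integral_coordinate:
  fixes g :: "'a \<Rightarrow> real"
  assumes [measurable]: "g \<in> borel_measurable M"
  shows "(\<integral>\<omega>. g (\<omega> k) \<partial>S) = (\<integral>x. g x \<partial>M)" "integrable S (\<lambda>\<omega>. g (\<omega> k)) \<longleftrightarrow> integrable M g"
  using integral_distr[of "\<lambda>\<omega>. \<omega> k" S M g] integrable_distr_eq[of "\<lambda>\<omega>. \<omega> k" S M g]
  by (simp_all add: distr_coordinate)

text \<open>The sum is a martingale transform: each weight \<open>H k\<close> depends only on the past of the centered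
variable that it multiplies. Consequently the cross terms in the square integrate to zero.\<close>

lemma (in sequence_space) martingale_transform_second_moment:
  fixes H :: "nat \<Rightarrow> (nat \<Rightarrow> 'a) \<Rightarrow> real"
  assumes H [measurable]: "\<And>k. H k \<in> borel_measurable S"
    and past: "\<And>k \<omega> \<omega>'. (\<And>i. i < k \<Longrightarrow> \<omega> i = \<omega>' i) \<Longrightarrow> H k \<omega> = H k \<omega>'"
    and bound: "\<And>k \<omega>. \<bar>H k \<omega>\<bar> \<le> c"
    and \<xi> [measurable]: "\<xi> \<in> borel_measurable M"
    and \<xi>2: "integrable M (\<lambda>x. (\<xi> x)\<^sup>2)" and \<xi>0: "(\<integral>x. \<xi> x \<partial>M) = 0"
  shows "integrable S (\<lambda>\<omega>. (\<Sum>k<N. H k \<omega> * \<xi> (\<omega> k))\<^sup>2) \<and>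
    (\<integral>\<omega>. (\<Sum>k<N. H k \<omega> * \<xi> (\<omega> k))\<^sup>2 \<partial>S) \<le> real N * (c\<^sup>2 * (\<integral>x. (\<xi> x)\<^sup>2 \<partial>M))"
proof (induction N)
  case (Suc N)
  interpret M: prob_space M by (rule prob_space)
  define Z where "Z \<omega> = (\<Sum>k<N. H k \<omega> * \<xi> (\<omega> k))" for \<omega>
  have [measurable]: "Z \<in> borel_measurable S" unfolding Z_def by measurable
  have Z2: "integrable S (\<lambda>\<omega>. (Z \<omega>)\<^sup>2)" using Suc.IH by (simp add: Z_def)
  then have Z1: "integrable S Z"
    by (rule square_integrable_imp_integrable[rotated]) simp
  have c: "0 \<le> c" using bound[of 0 undefined] by linarith
  have int_\<xi>: "integrable M \<xi>" using M.square_integrable_imp_integrable[OF \<xi> \<xi>2] .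
  have ZH: "integrable S (\<lambda>\<omega>. Z \<omega> * H N \<omega>)"
    by (rule Bochner_Integration.integrable_bound[OF integrable_mult_right[OF integrable_abs[OF Z1], of c]])
      (use bound c in \<open>auto simp: abs_mult mult.commute[of c] intro!: mult_left_mono\<close>)
  have ind: "indep_var borel (\<lambda>\<omega>. Z \<omega> * H N \<omega>) borel (\<lambda>\<omega>. \<xi> (\<omega> N))"
  proof (rule indep_past_present)
    fix \<omega> \<omega>' :: "nat \<Rightarrow> 'a" assume eq: "\<And>i. i < N \<Longrightarrow> \<omega> i = \<omega>' i"
    have "H k \<omega> = H k \<omega>'" if "k \<le> N" for k
      by (rule past) (use eq that in auto)
    then show "Z \<omega> * H N \<omega> = Z \<omega>' * H N \<omega>'"
      using eq by (simp add: Z_def)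
  qed simp_all
  have cross: "integrable S (\<lambda>\<omega>. Z \<omega> * H N \<omega> * \<xi> (\<omega> N))" "(\<integral>\<omega>. Z \<omega> * H N \<omega> * \<xi> (\<omega> N) \<partial>S) = 0"
    using indep_var_integrable[OF ind ZH] indep_var_lebesgue_integral[OF ind ZH] int_\<xi> \<xi>0
    by (simp_all add: integral_coordinate)
  have c\<xi>: "integrable S (\<lambda>\<omega>. c\<^sup>2 * (\<xi> (\<omega> N))\<^sup>2)" "(\<integral>\<omega>. c\<^sup>2 * (\<xi> (\<omega> N))\<^sup>2 \<partial>S) = c\<^sup>2 * (\<integral>x. (\<xi> x)\<^sup>2 \<partial>M)"
    using \<xi>2 integral_coordinate[of "\<lambda>x. c\<^sup>2 * (\<xi> x)\<^sup>2" N] by simp_all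
  have le: "(H N \<omega>)\<^sup>2 * (\<xi> (\<omega> N))\<^sup>2 \<le> c\<^sup>2 * (\<xi> (\<omega> N))\<^sup>2" for \<omega>
    using bound[of N \<omega>] c by (intro mult_right_mono) (auto simp: abs_le_square_iff[symmetric])
  have H\<xi>: "integrable S (\<lambda>\<omega>. (H N \<omega>)\<^sup>2 * (\<xi> (\<omega> N))\<^sup>2)"
    by (rule Bochner_Integration.integrable_bound[OF c\<xi>(1)]) (use le in auto)
  have exp: "(\<Sum>k<Suc N. H k \<omega> * \<xi> (\<omega> k))\<^sup>2 =
      (Z \<omega>)\<^sup>2 + 2 * (Z \<omega> * H N \<omega> * \<xi> (\<omega> N)) + (H N \<omega>)\<^sup>2 * (\<xi> (\<omega> N))\<^sup>2" for \<omega>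
    by (simp add: Z_def power2_eq_square algebra_simps)
  have "(\<integral>\<omega>. (\<Sum>k<Suc N. H k \<omega> * \<xi> (\<omega> k))\<^sup>2 \<partial>S) =
      (\<integral>\<omega>. (Z \<omega>)\<^sup>2 \<partial>S) + (\<integral>\<omega>. (H N \<omega>)\<^sup>2 * (\<xi> (\<omega> N))\<^sup>2 \<partial>S)"
    unfolding exp using Z2 cross H\<xi> by simp
  also have "\<dots> \<le> real N * (c\<^sup>2 * (\<integral>x. (\<xi> x)\<^sup>2 \<partial>M)) + c\<^sup>2 * (\<integral>x. (\<xi> x)\<^sup>2 \<partial>M)"
    using Suc.IH integral_mono[OF H\<xi> c\<xi>(1)] le unfolding c\<xi>(2) by (simp add: Z_def)
  finally have "(\<integral>\<omega>. (\<Sum>k<Suc N. H k \<omega> * \<xi> (\<omega> k))\<^sup>2 \<partial>S) \<le> real (Suc N) * (c\<^sup>2 * (\<integral>x. (\<xi> x)\<^sup>2 \<partial>M))"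
    by (simp add: distrib_right)
  moreover have "integrable S (\<lambda>\<omega>. (\<Sum>k<Suc N. H k \<omega> * \<xi> (\<omega> k))\<^sup>2)"
    unfolding exp using Z2 cross H\<xi> by simp
  ultimately show ?case by blast
qed simp

text \<open>The random walk with increments \<open>a (\<omega> n)\<close>, stopped when it leaves \<open>[- K, K]\<close>. It stays at the
first value outside this interval, so its final value alone decides whether it has ever left.\<close>

primrec stopped_walk :: "('a \<Rightarrow> real) \<Rightarrow> real \<Rightarrow> nat \<Rightarrow> (nat \<Rightarrow> 'a) \<Rightarrow> real" where
  "stopped_walk a K 0 \<omega> = 0"
| "stopped_walk a K (Suc n) \<omega> = stopped_walk a K n \<omega> +
     (if \<bar>stopped_walk a K n \<omega>\<bar> \<le> K then 1 else 0) * a (\<omega> n)"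

lemma stopped_walk_eq_sum:
  assumes "\<bar>stopped_walk a K n \<omega>\<bar> \<le> K" "m \<le> n"
  shows "stopped_walk a K m \<omega> = (\<Sum>i<m. a (\<omega> i)) \<and> \<bar>stopped_walk a K m \<omega>\<bar> \<le> K"
  using assms
proof (induction n arbitrary: m)
  case (Suc n)
  have n: "\<bar>stopped_walk a K n \<omega>\<bar> \<le> K"
    using Suc.prems(1) by (auto split: if_splits)
  show ?case
  proof (cases "m = Suc n")
    case True
    then show ?thesis using Suc.prems(1) Suc.IH[OF n order_refl] n by auto
  next
    case False
    then show ?thesis using Suc.prems(2) Suc.IH[OF n, of m] by linarith
  qed
qed simp

lemma stopped_walk_past:
  "(\<And>i. i < k \<Longrightarrow> \<omega> i = \<omega>' i) \<Longrightarrow> stopped_walk a K k \<omega> = stopped_walk a K k \<omega>'"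
  by (induction k) auto

lemma stopped_walk_eq_transform:
  "stopped_walk a K n \<omega> = (\<Sum>k<n. (if \<bar>stopped_walk a K k \<omega>\<bar> \<le> K then 1 else 0) * a (\<omega> k))"
  by (induction n) auto

lemma (in sequence_space) measurable_stopped_walk [measurable]:
  assumes [measurable]: "a \<in> borel_measurable M"
  shows "stopped_walk a K n \<in> borel_measurable S"
  by (induction n) (simp_all add: stopped_walk.simps[abs_def])

text \<open>A weak law of Marcinkiewicz-Zygmund type. Values up to a truncation level \<open>K\<close> contribute at most
\<open>N * K\<close>, which is of smaller order than \<open>N powr (1 / p)\<close> as \<open>p < 1\<close>. For the values above \<open>K\<close>,
subadditivity of the \<open>p\<close>-th power reduces the claim to Markov's inequality for a sum of truncated
moments, each of which is small once \<open>K\<close> is large.\<close>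

lemma (in sequence_space) heavy_tailed_sum:
  fixes Y :: "'a \<Rightarrow> real"
  assumes [measurable]: "Y \<in> borel_measurable M" and p: "0 < p" "p < 1"
    and int: "integrable M (\<lambda>x. \<bar>Y x\<bar> powr p)" and "0 < \<epsilon>"
  shows "(\<lambda>N. prob {\<omega> \<in> space S. \<epsilon> * real N powr (1 / p) \<le> (\<Sum>k<N. \<bar>Y (\<omega> k)\<bar>)}) \<longlonglongrightarrow> 0"
proof (rule LIMSEQ_I)
  fix \<delta> :: real assume "0 < \<delta>"
  define tail where "tail K x = (if real K < \<bar>Y x\<bar> then \<bar>Y x\<bar> powr p else 0)" for K x
  have [measurable]: "tail K \<in> borel_measurable M" for K
    unfolding tail_def by measurable
  have "(\<lambda>K. \<integral>x. tail K x \<partial>M) \<longlonglongrightarrow> (\<integral>x. 0 \<partial>M)"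
  proof (rule integral_dominated_convergence[OF _ _ int])
    show "AE x in M. (\<lambda>K. tail K x) \<longlonglongrightarrow> 0"
    proof (rule AE_I2)
      fix x
      obtain K0 where "\<bar>Y x\<bar> \<le> real K0" using real_arch_simple by blast
      then have "\<forall>\<^sub>F K in sequentially. tail K x = 0"
        by (intro eventually_sequentiallyI[of K0]) (auto simp: tail_def)
      then show "(\<lambda>K. tail K x) \<longlonglongrightarrow> 0" by (rule tendsto_eventually)
    qed
  qed (auto simp: tail_def)
  moreover have "0 < \<delta> * (\<epsilon> / 2) powr p" using \<open>0 < \<delta>\<close> \<open>0 < \<epsilon>\<close> by simp
  ultimately have "\<forall>\<^sub>F K in sequentially. (\<integral>x. tail K x \<partial>M) < \<delta> * (\<epsilon> / 2) powr p"
    by (intro order_tendstoD(2)) simp_all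
  then obtain K where K: "(\<integral>x. tail K x \<partial>M) < \<delta> * (\<epsilon> / 2) powr p"
    by (auto simp: eventually_sequentially)
  have tail_int: "integrable M (tail K)"
    by (rule Bochner_Integration.integrable_bound[OF int]) (auto simp: tail_def)
  define q where "q = 1 / p - 1"
  have "0 < q" using p by (simp add: q_def field_simps)
  obtain N0 where "(2 * real K / \<epsilon>) powr (1 / q) \<le> real N0"
    using real_arch_simple by blast
  have N0: "2 * real K / \<epsilon> \<le> real N powr (1 / p - 1)" if "N0 \<le> N" for N
  proof -
    have "2 * real K / \<epsilon> = ((2 * real K / \<epsilon>) powr (1 / q)) powr q"
      using \<open>0 < q\<close> \<open>0 < \<epsilon>\<close> by (simp add: powr_powr)
    also have "\<dots> \<le> real N powr q"
      using \<open>0 < q\<close> \<open>(2 * real K / \<epsilon>) powr (1 / q) \<le> real N0\<close> that by (intro powr_mono2) auto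
    finally show ?thesis by (simp add: q_def)
  qed
  show "\<exists>N0. \<forall>N\<ge>N0. norm (prob {\<omega> \<in> space S. \<epsilon> * real N powr (1 / p) \<le> (\<Sum>k<N. \<bar>Y (\<omega> k)\<bar>)} - 0) < \<delta>"
  proof (intro exI allI impI)
    fix N assume N: "max N0 1 \<le> N"
    have split: "real N powr (1 / p) = real N * real N powr (1 / p - 1)"
      using N by (simp add: powr_diff)
    have small: "real N * real K \<le> \<epsilon> / 2 * real N powr (1 / p)"
    proof -
      have "real K \<le> \<epsilon> / 2 * real N powr (1 / p - 1)"
        using N0[of N] N \<open>0 < \<epsilon>\<close> by (simp add: field_simps)
      then show ?thesis
        unfolding split by (metis mult.left_commute mult_left_mono of_nat_0_le_iff)
    qed
    have sub: "(\<epsilon> / 2) powr p * real N \<le> (\<Sum>k<N. tail K (\<omega> k))"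
      if "\<epsilon> * real N powr (1 / p) \<le> (\<Sum>k<N. \<bar>Y (\<omega> k)\<bar>)" for \<omega>
    proof -
      define T where "T k = (if real K < \<bar>Y (\<omega> k)\<bar> then \<bar>Y (\<omega> k)\<bar> else 0)" for k
      have "(\<Sum>k<N. \<bar>Y (\<omega> k)\<bar>) \<le> (\<Sum>k<N. real K + T k)"
        by (intro sum_mono) (auto simp: T_def)
      also have "\<dots> = real N * real K + (\<Sum>k<N. T k)"
        by (simp add: sum.distrib)
      finally have "\<epsilon> / 2 * real N powr (1 / p) \<le> (\<Sum>k<N. T k)"
        using small that by linarith
      then have "(\<epsilon> / 2 * real N powr (1 / p)) powr p \<le> (\<Sum>k<N. T k) powr p"
        using p \<open>0 < \<epsilon>\<close> by (intro powr_mono2) auto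
      also have "\<dots> \<le> (\<Sum>k<N. T k powr p)"
        using p by (intro powr_sum_le_sum_powr) (auto simp: T_def)
      also have "\<dots> = (\<Sum>k<N. tail K (\<omega> k))"
        by (intro sum.cong) (auto simp: T_def tail_def)
      also have "(\<epsilon> / 2 * real N powr (1 / p)) powr p = (\<epsilon> / 2) powr p * real N"
        using p \<open>0 < \<epsilon>\<close> by (subst powr_mult) (simp_all add: powr_powr)
      finally show ?thesis .
    qed
    have sum_int: "integrable S (\<lambda>\<omega>. \<Sum>k<N. tail K (\<omega> k))"
      using tail_int by (simp add: integral_coordinate)
    have "prob {\<omega> \<in> space S. \<epsilon> * real N powr (1 / p) \<le> (\<Sum>k<N. \<bar>Y (\<omega> k)\<bar>)}
        \<le> prob {\<omega> \<in> space S. (\<epsilon> / 2) powr p * real N \<le> (\<Sum>k<N. tail K (\<omega> k))}"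
      using sub by (intro finite_measure_mono) auto
    also have "\<dots> \<le> (\<integral>\<omega>. (\<Sum>k<N. tail K (\<omega> k)) \<partial>S) / ((\<epsilon> / 2) powr p * real N)"
      using N \<open>0 < \<epsilon>\<close> sum_int
      by (intro integral_Markov_inequality_measure[where A = "{}"]) (auto simp: tail_def intro!: sum_nonneg)
    also have "(\<integral>\<omega>. (\<Sum>k<N. tail K (\<omega> k)) \<partial>S) = real N * (\<integral>x. tail K x \<partial>M)"
      using tail_int by (simp add: integral_coordinate)
    also have "real N * (\<integral>x. tail K x \<partial>M) / ((\<epsilon> / 2) powr p * real N) = (\<integral>x. tail K x \<partial>M) / (\<epsilon> / 2) powr p"
      using N by simp
    also have "\<dots> < \<delta>"
      using K \<open>0 < \<epsilon>\<close> by (simp add: field_simps)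
    finally show "norm (prob {\<omega> \<in> space S. \<epsilon> * real N powr (1 / p) \<le> (\<Sum>k<N. \<bar>Y (\<omega> k)\<bar>)} - 0) < \<delta>"
      by simp
  qed
qed

text \<open>The main term is \<open>m * (\<Sum>k<N. A k\<^sup>2 / 2)\<close>, where \<open>m\<close> is the mean of \<open>b\<close> and \<open>A\<close> is the walk with
increments \<open>a\<close>; it is nonnegative. The other terms are compared with \<open>N\<^sup>2\<close> on the event that the
walk stays below \<open>C * sqrt N\<close>, whose complement has probability at most \<open>\<sigma> / C\<^sup>2\<close> by Chebyshev's
inequality for the stopped walk. On this event the fluctuation caused by \<open>b - m\<close> is a martingale
transform with weights of order \<open>N\<close>, so its second moment is of order \<open>N\<^sup>3\<close>; stopping is essential
here, because \<open>A\<close> need not have a fourth moment. The sums with \<open>t\<close> and \<open>w\<close> are of smaller order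
than \<open>sqrt N * N powr (3 / 2)\<close> and \<open>N\<^sup>2\<close> by the heavy-tailed law.\<close>

lemma (in sequence_space) walk_functional_lower_bound:
  fixes a b t w :: "'a \<Rightarrow> real"
  assumes [measurable]: "a \<in> borel_measurable M" "b \<in> borel_measurable M"
      "t \<in> borel_measurable M" "w \<in> borel_measurable M"
    and a2: "integrable M (\<lambda>x. (a x)\<^sup>2)" and a0: "(\<integral>x. a x \<partial>M) = 0"
    and b2: "integrable M (\<lambda>x. (b x)\<^sup>2)" and b0: "0 \<le> (\<integral>x. b x \<partial>M)"
    and t: "integrable M (\<lambda>x. \<bar>t x\<bar> powr (2 / 3))" and w: "integrable M (\<lambda>x. \<bar>w x\<bar> powr (1 / 2))"
    and "0 < \<epsilon>"
  shows "(\<lambda>N. prob {\<omega> \<in> space S. (\<Sum>k<N. (\<Sum>i<k. a (\<omega> i))\<^sup>2 / 2 * b (\<omega> k)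
      + (\<Sum>i<k. a (\<omega> i)) * t (\<omega> k) + w (\<omega> k)) < - \<epsilon> * (real N)\<^sup>2}) \<longlonglongrightarrow> 0"
    (is "(\<lambda>N. prob (?E N)) \<longlonglongrightarrow> 0")
proof (rule LIMSEQ_I)
  fix \<delta> :: real assume \<delta>: "0 < \<delta>"
  interpret M: prob_space M by (rule prob_space)
  define \<sigma> where "\<sigma> = (\<integral>x. (a x)\<^sup>2 \<partial>M)"
  define m where "m = (\<integral>x. b x \<partial>M)"
  define v where "v = (\<integral>x. (b x - m)\<^sup>2 \<partial>M)"
  have "0 \<le> \<sigma>" "0 \<le> v" by (simp_all add: \<sigma>_def v_def)
  \<comment> \<open>This choice makes \<open>\<sigma> / C\<^sup>2\<close> at most \<open>\<delta> / 4\<close>; the summand 1 keeps \<open>C\<close> positive if \<open>\<sigma> = 0\<close>.\<close>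
  define C where "C = sqrt (4 * (\<sigma> + 1) / \<delta>)"
  have C: "0 < C" "C\<^sup>2 = 4 * (\<sigma> + 1) / \<delta>"
    using \<open>0 \<le> \<sigma>\<close> \<delta> by (simp_all add: C_def)
  have b1: "integrable M b" using M.square_integrable_imp_integrable[OF _ b2] by simp
  have bc2: "integrable M (\<lambda>x. (b x - m)\<^sup>2)"
    using b1 b2 by (simp add: power2_diff)
  have bc0: "(\<integral>x. b x - m \<partial>M) = 0"
    using b1 by (simp add: m_def M.prob_space)
  define st where "st N = stopped_walk a (C * sqrt (real N))" for N
  \<comment> \<open>Setting the weight to zero after stopping bounds it by \<open>C\<^sup>2 N / 2\<close>.\<close>
  define H where "H N k \<omega> = (if \<bar>st N k \<omega>\<bar> \<le> C * sqrt (real N) then (st N k \<omega>)\<^sup>2 / 2 else 0)" for N k \<omega>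
  have [measurable]: "st N k \<in> borel_measurable S" for N k
    unfolding st_def by measurable
  have [measurable]: "H N k \<in> borel_measurable S" for N k
    unfolding H_def by measurable
  define E1 where "E1 N = {\<omega> \<in> space S. C * sqrt (real N) \<le> \<bar>st N N \<omega>\<bar>}" for N
  define E2 where "E2 N = {\<omega> \<in> space S. \<epsilon> / 3 * (real N)\<^sup>2 \<le> \<bar>\<Sum>k<N. H N k \<omega> * (b (\<omega> k) - m)\<bar>}" for N
  define E3 where "E3 N = {\<omega> \<in> space S. \<epsilon> / (3 * C) * real N powr (1 / (2 / 3)) \<le> (\<Sum>k<N. \<bar>t (\<omega> k)\<bar>)}" for N
  define E4 where "E4 N = {\<omega> \<in> space S. \<epsilon> / 3 * real N powr (1 / (1 / 2)) \<le> (\<Sum>k<N. \<bar>w (\<omega> k)\<bar>)}" for N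
  have [measurable]: "E1 N \<in> sets S" "E2 N \<in> sets S" "E3 N \<in> sets S" "E4 N \<in> sets S" for N
    unfolding E1_def E2_def E3_def E4_def by measurable
  have incl: "?E N \<subseteq> E1 N \<union> E2 N \<union> E3 N \<union> E4 N" if "1 \<le> N" for N
  proof
    fix \<omega> assume \<omega>: "\<omega> \<in> ?E N"
    show "\<omega> \<in> E1 N \<union> E2 N \<union> E3 N \<union> E4 N"
    proof (rule ccontr)
      assume neg: "\<omega> \<notin> E1 N \<union> E2 N \<union> E3 N \<union> E4 N"
      define A where "A k = (\<Sum>i<k. a (\<omega> i))" for k
      have "\<bar>st N N \<omega>\<bar> \<le> C * sqrt (real N)"
        using neg \<omega> by (simp add: E1_def)
      then have st: "st N k \<omega> = A k" "\<bar>A k\<bar> \<le> C * sqrt (real N)" if "k < N" for k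
        using stopped_walk_eq_sum[of a "C * sqrt (real N)" N \<omega> k] that by (auto simp: st_def A_def)
      have H: "H N k \<omega> = (A k)\<^sup>2 / 2" if "k < N" for k
        using st[OF that] by (simp add: H_def)
      have "(\<Sum>k<N. (A k)\<^sup>2 / 2 * b (\<omega> k)) = (\<Sum>k<N. H N k \<omega> * (b (\<omega> k) - m)) + m * (\<Sum>k<N. (A k)\<^sup>2 / 2)"
        unfolding sum_distrib_left sum.distrib[symmetric]
        by (intro sum.cong) (simp_all add: H field_simps)
      moreover have "0 \<le> m * (\<Sum>k<N. (A k)\<^sup>2 / 2)"
        using b0 by (intro mult_nonneg_nonneg sum_nonneg) (simp_all add: m_def)
      moreover have "- (\<epsilon> / 3 * (real N)\<^sup>2) < (\<Sum>k<N. H N k \<omega> * (b (\<omega> k) - m))"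
        using neg \<omega> unfolding E2_def by (auto simp: abs_if split: if_splits)
      moreover have "- (\<epsilon> / 3 * (real N)\<^sup>2) < (\<Sum>k<N. A k * t (\<omega> k))"
      proof -
        have "\<bar>\<Sum>k<N. A k * t (\<omega> k)\<bar> \<le> (\<Sum>k<N. C * sqrt (real N) * \<bar>t (\<omega> k)\<bar>)"
          using st(2) by (intro sum_abs[THEN order_trans] sum_mono) (auto simp: abs_mult intro!: mult_right_mono)
        also have "\<dots> = C * sqrt (real N) * (\<Sum>k<N. \<bar>t (\<omega> k)\<bar>)"
          by (simp add: sum_distrib_left)
        also have "\<dots> < C * sqrt (real N) * (\<epsilon> / (3 * C) * real N powr (3 / 2))"
          using neg \<omega> C \<open>1 \<le> N\<close> by (intro mult_strict_left_mono) (simp_all add: E3_def)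
        also have "\<dots> = \<epsilon> / 3 * (sqrt (real N) * real N powr (3 / 2))"
          using C by simp
        also have "sqrt (real N) * real N powr (3 / 2) = (real N)\<^sup>2"
          using \<open>1 \<le> N\<close> by (simp add: powr_half_sqrt[symmetric] powr_add[symmetric] powr_numeral)
        finally show ?thesis by linarith
      qed
      moreover have "- (\<epsilon> / 3 * (real N)\<^sup>2) < (\<Sum>k<N. w (\<omega> k))"
      proof -
        have "\<bar>\<Sum>k<N. w (\<omega> k)\<bar> \<le> (\<Sum>k<N. \<bar>w (\<omega> k)\<bar>)" by (rule sum_abs)
        also have "\<dots> < \<epsilon> / 3 * real N powr 2"
          using neg \<omega> by (simp add: E4_def)
        also have "real N powr 2 = (real N)\<^sup>2"
          using \<open>1 \<le> N\<close> by (simp add: powr_numeral)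
        finally show ?thesis by linarith
      qed
      moreover have "(\<Sum>k<N. (A k)\<^sup>2 / 2 * b (\<omega> k)) + (\<Sum>k<N. A k * t (\<omega> k)) + (\<Sum>k<N. w (\<omega> k)) < - \<epsilon> * (real N)\<^sup>2"
        using \<omega> by (simp add: A_def sum.distrib)
      moreover have "\<epsilon> / 3 * (real N)\<^sup>2 + \<epsilon> / 3 * (real N)\<^sup>2 + \<epsilon> / 3 * (real N)\<^sup>2 = \<epsilon> * (real N)\<^sup>2"
        by simp
      ultimately show False by linarith
    qed
  qed
  have P1: "prob (E1 N) \<le> \<delta> / 4" if "1 \<le> N" for N
  proof -
    define h where "h k \<omega> = (if \<bar>st N k \<omega>\<bar> \<le> C * sqrt (real N) then 1 else 0 :: real)" for k \<omega>
    have [measurable]: "h k \<in> borel_measurable S" for k unfolding h_def by measurable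
    have "integrable S (\<lambda>\<omega>. (\<Sum>k<N. h k \<omega> * a (\<omega> k))\<^sup>2) \<and>
        (\<integral>\<omega>. (\<Sum>k<N. h k \<omega> * a (\<omega> k))\<^sup>2 \<partial>S) \<le> real N * (1\<^sup>2 * \<sigma>)"
      unfolding \<sigma>_def
    proof (rule martingale_transform_second_moment[OF _ _ _ _ a2 a0])
      show "h k \<omega> = h k \<omega>'" if "\<And>i. i < k \<Longrightarrow> \<omega> i = \<omega>' i" for k \<omega> \<omega>'
        using stopped_walk_past[OF that] by (simp add: h_def st_def)
    qed (auto simp: h_def)
    moreover have "(\<Sum>k<N. h k \<omega> * a (\<omega> k)) = st N N \<omega>" for \<omega>
      unfolding h_def st_def by (rule stopped_walk_eq_transform[symmetric])
    ultimately have st2: "integrable S (\<lambda>\<omega>. (st N N \<omega>)\<^sup>2)" "(\<integral>\<omega>. (st N N \<omega>)\<^sup>2 \<partial>S) \<le> real N * \<sigma>"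
      by simp_all
    have "prob (E1 N) \<le> (\<integral>\<omega>. (st N N \<omega>)\<^sup>2 \<partial>S) / (C * sqrt (real N))\<^sup>2"
      unfolding E1_def using C \<open>1 \<le> N\<close> st2(1) by (intro second_moment_method) simp_all
    also have "\<dots> \<le> real N * \<sigma> / (C * sqrt (real N))\<^sup>2"
      by (intro divide_right_mono st2) simp
    also have "\<dots> = \<sigma> / C\<^sup>2"
      using \<open>1 \<le> N\<close> by (simp add: power_mult_distrib)
    also have "\<dots> \<le> \<delta> / 4"
      unfolding C using \<open>0 \<le> \<sigma>\<close> \<delta> by (simp add: field_simps)
    finally show ?thesis .
  qed
  define B2 where "B2 = (C\<^sup>2 / 2)\<^sup>2 * v / (\<epsilon> / 3)\<^sup>2"
  have P2: "prob (E2 N) \<le> B2 / real N" if "1 \<le> N" for N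
  proof -
    have K: "\<bar>H N k \<omega>\<bar> \<le> C\<^sup>2 * real N / 2" for k \<omega>
      using abs_le_square_iff[of "st N k \<omega>" "C * sqrt (real N)"] C(1)
      by (auto simp: H_def power_mult_distrib)
    have mart: "integrable S (\<lambda>\<omega>. (\<Sum>k<N. H N k \<omega> * (b (\<omega> k) - m))\<^sup>2) \<and>
        (\<integral>\<omega>. (\<Sum>k<N. H N k \<omega> * (b (\<omega> k) - m))\<^sup>2 \<partial>S) \<le> real N * ((C\<^sup>2 * real N / 2)\<^sup>2 * v)"
      unfolding v_def
    proof (rule martingale_transform_second_moment[OF _ _ K _ bc2 bc0])
      show "H N k \<omega> = H N k \<omega>'" if "\<And>i. i < k \<Longrightarrow> \<omega> i = \<omega>' i" for k \<omega> \<omega>'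
        using stopped_walk_past[OF that] by (simp add: H_def st_def)
    qed simp_all
    have "prob (E2 N) \<le> (\<integral>\<omega>. (\<Sum>k<N. H N k \<omega> * (b (\<omega> k) - m))\<^sup>2 \<partial>S) / (\<epsilon> / 3 * (real N)\<^sup>2)\<^sup>2"
      unfolding E2_def using \<open>0 < \<epsilon>\<close> \<open>1 \<le> N\<close> mart by (intro second_moment_method) simp_all
    also have "\<dots> \<le> real N * ((C\<^sup>2 * real N / 2)\<^sup>2 * v) / (\<epsilon> / 3 * (real N)\<^sup>2)\<^sup>2"
      using mart by (intro divide_right_mono) simp_all
    also have "\<dots> = B2 / real N"
      using \<open>1 \<le> N\<close> \<open>0 < \<epsilon>\<close> by (simp add: B2_def field_simps power2_eq_square)
    finally show ?thesis .
  qed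
  have L2: "\<forall>\<^sub>F N in sequentially. B2 / real N < \<delta> / 4"
    using order_tendstoD(2)[OF lim_const_over_n[of B2], of "\<delta> / 4"] \<delta> by simp
  have "(\<lambda>N. prob (E3 N)) \<longlonglongrightarrow> 0" "(\<lambda>N. prob (E4 N)) \<longlonglongrightarrow> 0"
    unfolding E3_def E4_def using C \<open>0 < \<epsilon>\<close> t w by (intro heavy_tailed_sum; simp)+
  from this[THEN order_tendstoD(2), of "\<delta> / 4"]
  have L34: "\<forall>\<^sub>F N in sequentially. prob (E3 N) < \<delta> / 4" "\<forall>\<^sub>F N in sequentially. prob (E4 N) < \<delta> / 4"
    using \<delta> by simp_all
  have "\<forall>\<^sub>F N in sequentially. prob (?E N) < \<delta>"
    using L2 L34 eventually_ge_at_top[of 1]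
  proof eventually_elim
    case (elim N)
    have "prob (?E N) \<le> prob (E1 N \<union> E2 N \<union> E3 N \<union> E4 N)"
      using incl elim by (intro finite_measure_mono) auto
    also have "\<dots> \<le> prob (E1 N) + prob (E2 N) + prob (E3 N) + prob (E4 N)"
      by (intro order_trans[OF measure_Un_le] add_mono order_refl) auto
    finally show ?case
      using P1[of N] P2[of N] elim by linarith
  qed
  then show "\<exists>N0. \<forall>N\<ge>N0. norm (prob (?E N) - 0) < \<delta>"
    by (auto simp: eventually_sequentially)
qed

section \<open>Products of independent group elements\<close>

lemma continuous_on_nested_bracket:
  fixes br :: "'a::euclidean_space \<Rightarrow> 'a \<Rightarrow> 'a" and hs :: "('b::t2_space \<Rightarrow> 'a) list"
  assumes br: "bilinear br" and hs: "\<And>h. h \<in> set hs \<Longrightarrow> continuous_on A h"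
  shows "continuous_on A (\<lambda>z. nested_bracket br (map (\<lambda>h. h z) hs))"
  using hs
proof (induction hs rule: induct_list012)
  case (3 f g hs)
  then show ?case
    using br by (auto intro!: bilinear_continuous_on_compose[of A _ _ br])
qed auto

text \<open>The group law is a polynomial, hence continuous.\<close>

lemma borel_measurable_group_mult:
  fixes br :: "'a::euclidean_space \<Rightarrow> 'a \<Rightarrow> 'a"
  assumes br: "bilinear br"
  shows "(\<lambda>(x, y). group_mult br s x y) \<in> borel_measurable (borel \<Otimes>\<^sub>M borel)"
proof -
  have word: "bch_word ps (fst z) (snd z) = map (\<lambda>h. h z) (bch_word ps fst snd)" for ps and z :: "'a \<times> 'a"
    by (simp add: bch_word_def map_concat comp_def case_prod_unfold)
  have mem: "h \<in> {fst, snd}" if "h \<in> set (bch_word ps fst snd)" for h :: "'a \<times> 'a \<Rightarrow> 'a" and ps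
    using that by (auto simp: bch_word_def split: if_splits)
  have "continuous_on UNIV (\<lambda>z. group_mult br s (fst z) (snd z))"
    unfolding group_mult_def word
    by (intro continuous_intros continuous_on_nested_bracket[OF br])
      (auto dest!: mem intro: continuous_intros)
  then show ?thesis
    by (simp add: borel_prod case_prod_unfold borel_measurable_continuous_onI)
qed

text \<open>The random walk on the group, driven by a sequence of increments.\<close>

primrec partial_product :: "('a::real_vector \<Rightarrow> 'a \<Rightarrow> 'a) \<Rightarrow> nat \<Rightarrow> nat \<Rightarrow> (nat \<Rightarrow> 'a) \<Rightarrow> 'a" where
  "partial_product br s 0 \<omega> = 0"
| "partial_product br s (Suc N) \<omega> = group_mult br s (partial_product br s N \<omega>) (\<omega> N)"

lemma partial_product_past:
  "(\<And>i. i < N \<Longrightarrow> \<omega> i = \<omega>' i) \<Longrightarrow> partial_product br s N \<omega> = partial_product br s N \<omega>'"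
  by (induction N) auto

lemma convolution_power_eq_distr:
  fixes br :: "'a::euclidean_space \<Rightarrow> 'a \<Rightarrow> 'a"
  assumes br: "bilinear br" and "prob_space M" and "sets M = sets borel"
  shows "partial_product br s N \<in> borel_measurable (\<Pi>\<^sub>M i\<in>UNIV. M) \<and>
    convolution_power br s M N = distr (\<Pi>\<^sub>M i\<in>UNIV. M) borel (partial_product br s N)"
proof (induction N)
  case 0
  interpret prob_space M by fact
  interpret sequence_space M by (rule sequence_spaceI)
  show ?case by (simp add: distr_const partial_product.simps(1)[abs_def])
next
  case (Suc N)
  interpret prob_space M by fact
  interpret sequence_space M by (rule sequence_spaceI)
  note [measurable] = borel_measurable_group_mult[OF br]
  have [measurable]: "partial_product br s N \<in> borel_measurable S"
    using Suc by simp
  have id: "(\<lambda>x. x) \<in> measurable M borel"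
    using assms(3) by (simp add: measurable_ident_sets)
  have [measurable]: "(\<lambda>\<omega>. \<omega> N) \<in> borel_measurable S"
    using measurable_compose[OF measurable_coordinate id] .
  have "distr S (borel \<Otimes>\<^sub>M borel) (\<lambda>\<omega>. (partial_product br s N \<omega>, \<omega> N)) =
      distr S borel (partial_product br s N) \<Otimes>\<^sub>M distr M borel (\<lambda>x. x)"
    by (rule distr_past_present[OF _ id partial_product_past]) simp_all
  also have "distr M borel (\<lambda>x. x) = M"
    using assms(3) by (simp add: distr_id2)
  finally have joint: "convolution_power br s M N \<Otimes>\<^sub>M M =
      distr S (borel \<Otimes>\<^sub>M borel) (\<lambda>\<omega>. (partial_product br s N \<omega>, \<omega> N))"
    using Suc by simp
  have "convolution_power br s M (Suc N) =
      distr S borel (\<lambda>\<omega>. group_mult br s (partial_product br s N \<omega>) (\<omega> N))"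
    by (simp add: group_convolution_def joint distr_distr comp_def)
  moreover have "(\<lambda>\<omega>. group_mult br s (partial_product br s N \<omega>) (\<omega> N)) \<in> borel_measurable S"
    by measurable
  ultimately show ?case by (simp add: partial_product.simps(2)[abs_def])
qed

lemma pair_measure_return:
  assumes "c \<in> space N"
  shows "M \<Otimes>\<^sub>M return N c = distr M (M \<Otimes>\<^sub>M N) (\<lambda>x. (x, c))"
proof (rule measure_eqI)
  have [measurable]: "(\<lambda>x. (x, c)) \<in> measurable M (M \<Otimes>\<^sub>M N)"
    using assms by simp
  interpret R: prob_space "return N c" using assms by (rule prob_space_return)
  show sets: "sets (M \<Otimes>\<^sub>M return N c) = sets (distr M (M \<Otimes>\<^sub>M N) (\<lambda>x. (x, c)))"
    by (simp cong: sets_pair_measure_cong)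
  fix A assume "A \<in> sets (M \<Otimes>\<^sub>M return N c)"
  then have A: "A \<in> sets (M \<Otimes>\<^sub>M N)" using sets by simp
  have "emeasure (M \<Otimes>\<^sub>M return N c) A = (\<integral>\<^sup>+ x. emeasure (return N c) (Pair x -` A) \<partial>M)"
    using A sets by (intro R.emeasure_pair_measure_alt) simp
  also have "\<dots> = (\<integral>\<^sup>+ x. indicator ((\<lambda>x. (x, c)) -` A \<inter> space M) x \<partial>M)"
    using sets_Pair1[OF A] by (intro nn_integral_cong) (auto split: split_indicator)
  also have "\<dots> = emeasure M ((\<lambda>x. (x, c)) -` A \<inter> space M)"
    using A by (intro nn_integral_indicator measurable_sets[of _ _ "M \<Otimes>\<^sub>M N"]) simp_all
  also have "\<dots> = emeasure (distr M (M \<Otimes>\<^sub>M N) (\<lambda>x. (x, c))) A"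
    using A by (simp add: emeasure_distr)
  finally show "emeasure (M \<Otimes>\<^sub>M return N c) A = emeasure (distr M (M \<Otimes>\<^sub>M N) (\<lambda>x. (x, c))) A" .
qed

lemma group_convolution_return:
  fixes br :: "'a::euclidean_space \<Rightarrow> 'a \<Rightarrow> 'a"
  assumes br: "bilinear br" and "sets \<eta> = sets borel"
  shows "group_convolution br s \<eta> (return borel c) = distr \<eta> borel (\<lambda>x. group_mult br s x c)"
proof -
  have [measurable_cong]: "sets \<eta> = sets borel" by fact
  note [measurable] = borel_measurable_group_mult[OF br]
  show ?thesis
    unfolding group_convolution_def
    by (subst pair_measure_return) (simp_all add: distr_distr comp_def)
qed

text \<open>If \<open>\<phi>\<close> were positive at a point of the support, then the open set where it is positive would have
positive measure.\<close>

lemma support_zero_of_integral_zero: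
  fixes \<phi> :: "'a::euclidean_space \<Rightarrow> real"
  assumes "prob_space \<nu>" "sets \<nu> = sets borel"
    and cont: "continuous_on UNIV \<phi>" and range: "\<And>x. 0 \<le> \<phi> x" "\<And>x. \<phi> x \<le> 1"
    and zero: "(\<integral>x. \<phi> x \<partial>\<nu>) = 0" and x: "x \<in> measure_support \<nu>"
  shows "\<phi> x = 0"
proof (rule ccontr)
  assume "\<phi> x \<noteq> 0"
  interpret prob_space \<nu> by fact
  have [measurable_cong]: "sets \<nu> = sets borel" by fact
  have [measurable]: "\<phi> \<in> borel_measurable borel"
    by (rule borel_measurable_continuous_onI[OF cont])
  have "integrable \<nu> \<phi>"
    by (rule integrable_const_bound[of _ 1]) (use range in auto)
  then have "AE y in \<nu>. \<phi> y = 0"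
    using zero range by (subst (asm) integral_nonneg_eq_0_iff_AE) auto
  then have "emeasure \<nu> {y \<in> space \<nu>. \<not> \<phi> y = 0} = 0"
    by (intro AE_iff_measurable[THEN iffD1, OF _ refl]) measurable
  moreover have "{y \<in> space \<nu>. \<not> \<phi> y = 0} = {y. 0 < \<phi> y}"
    using range sets_eq_imp_space_eq[OF assms(2)] by (auto simp: less_le)
  moreover have "open {y. 0 < \<phi> y}"
    using cont by (intro open_Collect_less) auto
  ultimately show False
    using x \<open>\<phi> x \<noteq> 0\<close> range(1)[of x] by (fastforce simp: measure_support_def)
qed

text \<open>A functional that kills brackets factors through the abelianization, where the mean is that of
\<open>X\<close>. A nonzero Bochner integral certifies the integrability that is needed to exchange it with
a linear map.\<close>

lemma integral_abelian_functional:
  fixes ab :: "'a::euclidean_space \<Rightarrow> 'b::euclidean_space" and f :: "'a \<Rightarrow> real"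
  assumes ab: "abelianization_map br ab" and "sets \<mu> = sets borel"
    and nz: "(\<integral>y. y \<partial>(distr \<mu> borel ab)) \<noteq> 0" and X: "ab X = (\<integral>y. y \<partial>(distr \<mu> borel ab))"
    and f: "linear f" "\<And>x y. f (br x y) = 0"
  shows "(\<integral>x. f x \<partial>\<mu>) = f X"
proof -
  have [measurable_cong]: "sets \<mu> = sets borel" by fact
  have "linear ab" "surj ab" and ker: "{x. ab x = 0} = bracket_span br UNIV UNIV"
    using ab by (auto simp: abelianization_map_def)
  have [measurable]: "ab \<in> borel_measurable borel"
    by (rule linear_borel_measurable) fact
  obtain g where g: "linear g" "ab \<circ> g = id"
    using linear_surjective_right_inverse[OF \<open>linear ab\<close> \<open>surj ab\<close>] by blast
  have "subspace {x. f x = 0}"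
    using f(1) by (auto simp: subspace_def linear_0 linear_add linear_scale)
  then have "bracket_span br UNIV UNIV \<subseteq> {x. f x = 0}"
    using f(2) by (intro bracket_span_least) auto
  moreover have "ab (x - g (ab x)) = 0" for x
    using g(2) linear_diff[OF \<open>linear ab\<close>] by (simp add: fun_eq_iff)
  ultimately have "f (x - g (ab x)) = 0" for x using ker by blast
  then have factor: "f x = f (g (ab x))" for x using linear_diff[OF f(1)] by simp
  have fg: "bounded_linear (\<lambda>y. f (g y))"
    using linear_compose[OF g(1) f(1)] by (simp add: comp_def linear_conv_bounded_linear)
  have mean: "(\<integral>y. y \<partial>(distr \<mu> borel ab)) = (\<integral>x. ab x \<partial>\<mu>)"
    by (rule integral_distr) simp_all
  then have "integrable \<mu> ab" using nz not_integrable_integral_eq by metis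
  then have "(\<integral>x. f (g (ab x)) \<partial>\<mu>) = f (g (\<integral>x. ab x \<partial>\<mu>))"
    by (rule integral_bounded_linear[OF fg])
  then show ?thesis using factor X mean by (metis (no_types, lifting) Bochner_Integration.integral_cong)
qed

text \<open>This iterates the splitting of words over the increments of the walk.\<close>

lemma partial_product_filiform:
  assumes f: "filiform_coordinates br f0 f1 f2 f3" "3 \<le> s"
  shows "f1 (partial_product br s N \<omega>) = (\<Sum>k<N. f1 (\<omega> k))"
    and "word110 f0 f1 f2 f3 (partial_product br s N \<omega>) =
      (\<Sum>k<N. (\<Sum>i<k. f1 (\<omega> i))\<^sup>2 / 2 * f0 (\<omega> k) + (\<Sum>i<k. f1 (\<omega> i)) * word10 f0 f1 f2 (\<omega> k)
        + word110 f0 f1 f2 f3 (\<omega> k))"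
proof -
  have "f0 0 = 0" "f1 0 = 0" "f2 0 = 0" "f3 0 = 0"
    using f(1) by (auto simp: filiform_coordinates_def linear_0)
  then show *: "f1 (partial_product br s N \<omega>) = (\<Sum>k<N. f1 (\<omega> k))" for N
    by (induction N) (simp_all add: filiform_group_mult[OF f])
  show "word110 f0 f1 f2 f3 (partial_product br s N \<omega>) =
      (\<Sum>k<N. (\<Sum>i<k. f1 (\<omega> i))\<^sup>2 / 2 * f0 (\<omega> k) + (\<Sum>i<k. f1 (\<omega> i)) * word10 f0 f1 f2 (\<omega> k)
        + word110 f0 f1 f2 f3 (\<omega> k))"
  proof (induction N)
    case 0
    show ?case using \<open>f1 0 = 0\<close> \<open>f3 0 = 0\<close> by (simp add: word110_def)
  next
    case (Suc N)
    then show ?case by (simp add: word110_group_mult[OF f] *)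
  qed
qed

section \<open>The inequality on the support of the limit\<close>

text \<open>The setting of the limit argument: a weight decomposition together with filiform coordinates in
which \<open>X\<close> is the basis vector \<open>e\<^sub>0\<close>.\<close>

locale filiform_limit = graded_complements br s X m
  for br :: "'a::euclidean_space \<Rightarrow> 'a \<Rightarrow> 'a" and s X m +
  fixes f0 f1 f2 f3 :: "'a \<Rightarrow> real" and Y :: 'a
  assumes bil: "bilinear br" and step3: "3 \<le> s" and coords: "filiform_coordinates br f0 f1 f2 f3"
    and X: "f0 X = 1" "f1 X = 0" "f2 X = 0" "f3 X = 0" and Y: "f1 Y = 1"
begin

lemma lin: "linear f0" "linear f1" "linear f2" "linear f3"
  and bracket [simp]: "f0 (br x y) = 0" "f1 (br x y) = 0"
    "f2 (br x y) = f1 x * f0 y - f0 x * f1 y" "f3 (br x y) = f1 x * f2 y - f2 x * f1 y"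
  using coords by (auto simp: filiform_coordinates_def)

text \<open>The coordinates along \<open>e\<^sub>1\<close>, \<open>e\<^sub>2\<close>, \<open>e\<^sub>3\<close> have weights 1, 3, 4: the vector \<open>X\<close> counts twice when
it is bracketed with another one. This is what the next three lemmas express. The functional \<open>f0\<close>
has weight 1, as does every functional on the abelianization.\<close>

lemma f01_vanish: "x \<in> G (Suc (Suc i)) \<Longrightarrow> f0 x = 0 \<and> f1 x = 0"
proof -
  have "subspace {x. f0 x = 0 \<and> f1 x = 0}"
    by (auto simp: subspace_def lin[THEN linear_0] lin[THEN linear_add] lin[THEN linear_scale])
  then have "G (Suc (Suc i)) \<subseteq> {x. f0 x = 0 \<and> f1 x = 0}"
    by (rule weight_filtration_least) auto
  then show "x \<in> G (Suc (Suc i)) \<Longrightarrow> f0 x = 0 \<and> f1 x = 0" by auto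
qed

lemma f2_vanish: "x \<in> G 4 \<Longrightarrow> f2 x = 0"
proof -
  have "subspace {x. f2 x = 0}"
    by (auto simp: subspace_def lin[THEN linear_0] lin[THEN linear_add] lin[THEN linear_scale])
  then have "G (Suc (Suc (Suc (Suc 0)))) \<subseteq> {x. f2 x = 0}"
    by (rule weight_filtration_least) (auto dest: f01_vanish simp del: weight_filtration.simps)
  then show "x \<in> G 4 \<Longrightarrow> f2 x = 0" by (auto simp: numeral_eq_Suc simp del: weight_filtration.simps)
qed

lemma f3_vanish: "x \<in> G 5 \<Longrightarrow> f3 x = 0"
proof -
  have 4: "Suc (Suc (Suc (Suc 0))) = 4" by simp
  have "subspace {x. f3 x = 0}"
    by (auto simp: subspace_def lin[THEN linear_0] lin[THEN linear_add] lin[THEN linear_scale])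
  then have "G (Suc (Suc (Suc (Suc (Suc 0))))) \<subseteq> {x. f3 x = 0}"
  proof (rule weight_filtration_least)
    show "br v w \<in> {x. f3 x = 0}" if "w \<in> G (Suc (Suc (Suc (Suc 0))))" for v w
      using f01_vanish[OF that] f2_vanish[of w] that unfolding 4 by simp
  qed (simp add: X)
  then show "x \<in> G 5 \<Longrightarrow> f3 x = 0" by (auto simp: numeral_eq_Suc simp del: weight_filtration.simps)
qed

lemma five_le_n: "5 \<le> n" using step3 by simp

lemma f0_proj: "f0 x = f0 (proj 1 x)" and f1_proj: "f1 x = f1 (proj 1 x)"
  using functional_eq_sum_proj[OF lin(1), of 1 x] functional_eq_sum_proj[OF lin(2), of 1 x]
    f01_vanish five_le_n by (simp_all del: weight_filtration.simps)

lemma f2_proj: "f2 x = f2 (proj 1 x) + f2 (proj 2 x) + f2 (proj 3 x)"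
  using functional_eq_sum_proj[OF lin(3), of 3 x] f2_vanish five_le_n
  by (simp add: numeral_eq_Suc del: weight_filtration.simps)

lemma f3_proj: "f3 x = f3 (proj 1 x) + f3 (proj 2 x) + f3 (proj 3 x) + f3 (proj 4 x)"
  using functional_eq_sum_proj[OF lin(4), of 4 x] f3_vanish five_le_n
  by (simp add: numeral_eq_Suc del: weight_filtration.simps)

text \<open>The part of \<open>W + N f\<^sub>1\<^sup>2 / 2\<close> of exact weight 4, for \<open>W = word110 f0 f1 f2 f3\<close>, when the factor
\<open>N\<close> is given weight 2. In terms of the limiting diffusion it is \<open>\<integral> A(t)\<^sup>2 dt / 2\<close>, written as a
function of the endpoint.\<close>

definition limit_form :: "'a \<Rightarrow> real" where
  "limit_form u = f3 (proj 4 u) + f1 u * f2 (proj 3 u) / 2 + (f1 u)\<^sup>2 / 2"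

text \<open>The part of lower weight, where \<open>h\<close> stands for \<open>1 / sqrt N\<close>.\<close>

definition remainder :: "real \<Rightarrow> 'a \<Rightarrow> real" where
  "remainder h u = f3 (proj 3 u) + h * f3 (proj 2 u) + h\<^sup>2 * f3 (proj 1 u)
     + f1 u * (f2 (proj 2 u) + h * f2 (proj 1 u)) / 2 + (f1 u)\<^sup>2 * f0 u / 6"

text \<open>Each component of weight \<open>i\<close> of \<open>x\<close> is \<open>r ^ i\<close> times that of its dilation by \<open>1 / r\<close>.\<close>

lemma word110_rescaled:
  assumes "0 < r"
  shows "word110 f0 f1 f2 f3 x + r\<^sup>2 * (f1 x)\<^sup>2 / 2 =
    r ^ 4 * (limit_form (dilation s m (1 / r) x) + 1 / r * remainder (1 / r) (dilation s m (1 / r) x))"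
proof -
  define u where "u = dilation s m (1 / r) x"
  have P: "proj i x = r ^ i *\<^sub>R proj i u" for i
    using assms by (simp add: u_def proj_dilation power_divide)
  have 0: "f0 x = r * f0 u" and 1: "f1 x = r * f1 u"
    unfolding f0_proj[of x] f1_proj[of x] f0_proj[of u] f1_proj[of u] P
    by (simp_all add: lin[THEN linear_scale])
  have 2: "f2 x = r * f2 (proj 1 u) + r\<^sup>2 * f2 (proj 2 u) + r ^ 3 * f2 (proj 3 u)"
    unfolding f2_proj[of x] P by (simp add: lin[THEN linear_scale])
  have 3: "f3 x = r * f3 (proj 1 u) + r\<^sup>2 * f3 (proj 2 u) + r ^ 3 * f3 (proj 3 u) + r ^ 4 * f3 (proj 4 u)"
    unfolding f3_proj[of x] P by (simp add: lin[THEN linear_scale])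
  show ?thesis
    unfolding u_def[symmetric] word110_def limit_form_def remainder_def 0 1 2 3
    using assms by (simp add: field_simps power2_eq_square power3_eq_cube power4_eq_xxxx)
qed

lemma continuous_functional:
  "linear f \<Longrightarrow> continuous_on A g \<Longrightarrow> continuous_on A (\<lambda>z. f (g z))"
  for f :: "'a \<Rightarrow> 'b::real_normed_vector" and g :: "'c::topological_space \<Rightarrow> 'a"
  by (simp add: linear_conv_bounded_linear bounded_linear.continuous_on)

lemma continuous_limit_form: "continuous_on UNIV limit_form"
  unfolding limit_form_def[abs_def]
  by (intro continuous_intros continuous_functional[OF lin(1)] continuous_functional[OF lin(2)]
      continuous_functional[OF lin(3)] continuous_functional[OF lin(4)] continuous_functional[OF linear_proj])
    auto

text \<open>The remainder is jointly continuous in \<open>h\<close> and \<open>u\<close>, and these range over a compact set.\<close>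

lemma remainder_bounded:
  obtains B where "0 \<le> B" "\<And>h u. 0 \<le> h \<Longrightarrow> h \<le> 1 \<Longrightarrow> norm u \<le> R \<Longrightarrow> \<bar>remainder h u\<bar> \<le> B"
proof -
  let ?K = "{0..1::real} \<times> cball (0::'a) R"
  have "continuous_on ?K (\<lambda>z. remainder (fst z) (snd z))"
    unfolding remainder_def
    by (intro continuous_intros continuous_functional[OF lin(1)] continuous_functional[OF lin(2)]
        continuous_functional[OF lin(3)] continuous_functional[OF lin(4)] continuous_functional[OF linear_proj])
      auto
  then have "bounded ((\<lambda>z. remainder (fst z) (snd z)) ` ?K)"
    by (intro compact_imp_bounded compact_continuous_image compact_Times) auto
  then obtain B where B: "\<And>y. y \<in> (\<lambda>z. remainder (fst z) (snd z)) ` ?K \<Longrightarrow> norm y \<le> B"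
    unfolding bounded_iff by blast
  have "\<bar>remainder h u\<bar> \<le> B" if "0 \<le> h" "h \<le> 1" "norm u \<le> R" for h u
    using B[OF imageI, of "(h, u)"] that by simp
  then show thesis
    by (intro that[of "max B 0"]) (auto simp: le_max_iff_disj)
qed

text \<open>The element \<open>[Y, [X, Y]]\<close> has weight 4 and \<open>f3\<close> takes the value \<open>- 1\<close> on it. Passing to its
component \<open>a\<close> of weight 4 changes neither \<open>f1\<close> nor \<open>f3\<close>, and along the ray through \<open>a\<close> only the
first term of the form is nonzero.\<close>

lemma limit_form_negative_near_0:
  assumes "open U" "0 \<in> U"
  obtains u where "u \<in> U" "limit_form u < 0"
proof -
  have "br X Y \<in> G (Suc (Suc (Suc 0)))"
    by (rule bracket_mean_in_weight_filtration) simp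
  then have "br Y (br X Y) \<in> G (Suc (Suc (Suc (Suc 0))))"
    by (rule bracket_in_weight_filtration)
  then have "br Y (br X Y) \<in> G 4"
    by (simp add: numeral_eq_Suc del: weight_filtration.simps)
  also have "G 4 = subspace_sum (m 4) (G 5)"
    using m_facts(3)[of 4] five_le_n by simp
  finally obtain a b where a: "a \<in> m 4" and b: "b \<in> G 5" and ab: "br Y (br X Y) = a + b"
    unfolding subspace_sum_def by blast
  have "f1 a = f1 (br Y (br X Y)) - f1 b" "f3 a = f3 (br Y (br X Y)) - f3 b"
    by (simp_all only: ab lin[THEN linear_add] add_diff_cancel_right')
  then have fa: "f1 a = 0" "f3 a = - 1"
    using f3_vanish[OF b] f01_vanish[of b "Suc (Suc (Suc 0))"] b X Y by (auto simp: numeral_eq_Suc simp del: weight_filtration.simps)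
  have "((\<lambda>c. c *\<^sub>R a) \<longlongrightarrow> 0 *\<^sub>R a) (at_right (0::real))"
    by (intro tendsto_intros)
  then have "\<forall>\<^sub>F c in at_right (0::real). c *\<^sub>R a \<in> U"
    using assms by (intro topological_tendstoD) auto
  then have "\<forall>\<^sub>F c in at_right (0::real). c *\<^sub>R a \<in> U \<and> 0 < c"
    by (intro eventually_conj eventually_at_right_less)
  then obtain c :: real where c: "c *\<^sub>R a \<in> U" "0 < c"
    using eventually_happens' trivial_limit_at_right_real by blast
  have "c *\<^sub>R a \<in> m 4" using m_facts(1)[of 4] five_le_n a by (auto intro: subspace_scale)
  then have "limit_form (c *\<^sub>R a) = - c"
    using proj_of_m[of 4 "c *\<^sub>R a"] five_le_n fa
    by (simp add: limit_form_def lin[THEN linear_scale] lin[THEN linear_0])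
  then show thesis using that[of "c *\<^sub>R a"] c by simp
qed

text \<open>A component of weight \<open>i\<close> has a moment of order \<open>2 / i\<close>, so a polynomial of weight at most \<open>i\<close> in the
coordinates has one as well. The two word coefficients have weights 3 and 4.\<close>

lemma finite_moments:
  assumes "prob_space \<mu>" and "sets \<mu> = sets borel" and "finite_weighted_second_moment s m \<mu>"
  shows "finite_moment \<mu> 2 f0" "finite_moment \<mu> 2 f1"
    "finite_moment \<mu> (2 / 3) (word10 f0 f1 f2)" "finite_moment \<mu> (1 / 2) (word110 f0 f1 f2 f3)"
proof -
  interpret prob_space \<mu> by fact
  have [measurable_cong]: "sets \<mu> = sets borel" by fact
  have fm: "finite_measure \<mu>" by (rule finite_measure_axioms)
  have proj_moment: "finite_moment \<mu> (2 / real i) (\<lambda>x. f (proj i x))" if "linear f" "i \<in> {1..n}" for f :: "'a \<Rightarrow> real" and i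
  proof -
    obtain c where c: "0 < c" "\<And>x. norm (f x) \<le> c * norm x"
      using linear_bounded_pos[OF \<open>linear f\<close>] by blast
    have "linear (\<lambda>x. f (proj i x))"
      using linear_compose[OF linear_proj that(1)] by (simp add: comp_def)
    then have "(\<lambda>x. f (proj i x)) \<in> borel_measurable borel"
      by (rule linear_borel_measurable)
    then have meas: "(\<lambda>x. f (proj i x)) \<in> borel_measurable \<mu>"
      by simp
    have "integrable \<mu> (\<lambda>x. c powr (2 / real i) * norm (proj i x) powr (2 / real i))"
      using assms(3) that(2) by (simp add: finite_weighted_second_moment_def)
    with meas show ?thesis
    proof (rule finite_moment_bounded)
      show "\<bar>f (proj i x)\<bar> powr (2 / real i) \<le> c powr (2 / real i) * norm (proj i x) powr (2 / real i)" for x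
        using c(2)[of "proj i x"] c(1) by (simp add: powr_mult[symmetric] powr_mono2)
    qed
  qed
  have n: "1 \<in> {1..n}" "2 \<in> {1..n}" "3 \<in> {1..n}" "4 \<in> {1..n}" using five_le_n by auto
  show m0: "finite_moment \<mu> 2 f0" and m1: "finite_moment \<mu> 2 f1"
    using proj_moment[OF lin(1) n(1)] proj_moment[OF lin(2) n(1)]
    unfolding f0_proj[symmetric] f1_proj[symmetric] by simp_all
  have lower: "finite_moment \<mu> p (\<lambda>x. f (proj i x))"
    if "linear f" "i \<in> {1..n}" "0 < p" "p \<le> 2 / real i" for f :: "'a \<Rightarrow> real" and i p
    using finite_moment_le[OF fm proj_moment[OF that(1,2)] that(3,4)] .
  have "finite_moment \<mu> (2 / 3) (\<lambda>x. f2 (proj 1 x) + f2 (proj 2 x) + f2 (proj 3 x))"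
    by (intro finite_moment_add lower lin n) simp_all
  then have m2: "finite_moment \<mu> (2 / 3) f2"
    unfolding f2_proj[symmetric] .
  have "finite_moment \<mu> (1 / 2)
      (\<lambda>x. f3 (proj 1 x) + f3 (proj 2 x) + f3 (proj 3 x) + f3 (proj 4 x))"
    by (intro finite_moment_add lower lin n) simp_all
  then have m3: "finite_moment \<mu> (1 / 2) f3"
    unfolding f3_proj[symmetric] .
  have "finite_moment \<mu> 1 (\<lambda>x. f0 x * f1 x)"
    by (rule finite_moment_mult[OF m0 m1]) simp_all
  then have "finite_moment \<mu> (2 / 3) (\<lambda>x. f0 x * f1 x)"
    by (rule finite_moment_le[OF fm]) simp_all
  from finite_moment_add[OF m2 finite_moment_cmult[OF this, of "1 / 2"]]
  show "finite_moment \<mu> (2 / 3) (word10 f0 f1 f2)"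
    by (simp add: word10_def[abs_def])
  have "finite_moment \<mu> 1 (\<lambda>x. f1 x * f1 x)"
    by (rule finite_moment_mult[OF m1 m1]) simp_all
  then have "finite_moment \<mu> (2 / 3) (\<lambda>x. f1 x * f1 x * f0 x)"
    by (rule finite_moment_mult[OF _ m0]) simp_all
  then have 110: "finite_moment \<mu> (1 / 2) (\<lambda>x. f1 x * f1 x * f0 x)"
    by (rule finite_moment_le[OF fm]) simp_all
  have 12: "finite_moment \<mu> (1 / 2) (\<lambda>x. f1 x * f2 x)"
    by (rule finite_moment_mult[OF m1 m2]) simp_all
  from finite_moment_add[OF finite_moment_add[OF m3 finite_moment_cmult[OF 12, of "1 / 2"]]
      finite_moment_cmult[OF 110, of "1 / 6"]]
  show "finite_moment \<mu> (1 / 2) (word110 f0 f1 f2 f3)"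
    by (simp add: word110_def[abs_def] power2_eq_square)
qed

lemma word110_recentered:
  "word110 f0 f1 f2 f3 (group_mult br s x (- (c *\<^sub>R X))) = word110 f0 f1 f2 f3 x - c * (f1 x)\<^sup>2 / 2"
  "f1 (group_mult br s x (- (c *\<^sub>R X))) = f1 x"
  by (simp_all add: word110_group_mult[OF coords step3] filiform_group_mult[OF coords step3]
      word10_def word110_def lin[THEN linear_neg] lin[THEN linear_scale] X field_simps power2_eq_square)

text \<open>If the form were negative at a point of the support, a bump function \<open>\<phi>\<close> at this point would be
supported where the form is less than \<open>- \<eta>\<close> and the norm is bounded. On that set the remainder is
negligible for large \<open>N\<close>, so that the word coefficient of the walk is less than \<open>- (\<eta> / 2) N\<^sup>2\<close>.
The probability of this tends to zero, and with it the integral of \<open>\<phi>\<close>.\<close>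

lemma limit_form_nonneg_on_support:
  assumes \<mu>: "prob_space \<mu>" "sets \<mu> = sets borel"
    and moments: "finite_weighted_second_moment s m \<mu>"
    and mean: "(\<integral>x. f0 x \<partial>\<mu>) = 1" "(\<integral>x. f1 x \<partial>\<mu>) = 0"
    and \<nu>: "prob_space \<nu>" "sets \<nu> = sets borel"
    and limit: "weakly_converges_to
      (\<lambda>N. distr (group_convolution br s (convolution_power br s \<mu> N) (return borel (- (real N *\<^sub>R X))))
                 borel (dilation s m (1 / sqrt (real N)))) \<nu>"
    and u: "u \<in> measure_support \<nu>"
  shows "0 \<le> limit_form u"
proof (rule ccontr)
  assume neg: "\<not> 0 \<le> limit_form u"
  interpret \<mu>: prob_space \<mu> by fact
  interpret sequence_space \<mu> by (rule \<mu>.sequence_spaceI)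
  define \<eta> where "\<eta> = - limit_form u / 2"
  define R where "R = norm u + 1"
  have "0 < \<eta>" using neg by (simp add: \<eta>_def)
  define \<phi> where "\<phi> v = min 1 (max 0 (min (- limit_form v - \<eta>) (R - norm v)))" for v
  have cont: "continuous_on UNIV \<phi>"
    unfolding \<phi>_def[abs_def]
    by (intro continuous_intros continuous_on_min continuous_on_max continuous_limit_form)
  have \<phi>: "0 \<le> \<phi> v" "\<phi> v \<le> 1" for v by (auto simp: \<phi>_def)
  have [measurable]: "\<phi> \<in> borel_measurable borel"
    by (rule borel_measurable_continuous_onI[OF cont])
  define P where "P N = partial_product br s N" for N
  define U where "U N \<omega> = dilation s m (1 / sqrt (real N)) (group_mult br s (P N \<omega>) (- (real N *\<^sub>R X)))" for N \<omega>
  have P [measurable]: "P N \<in> borel_measurable S" and cp: "convolution_power br s \<mu> N = distr S borel (P N)" for N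
    using convolution_power_eq_distr[OF bil \<mu>] by (auto simp: P_def)
  have gm: "(\<lambda>x. group_mult br s x c) \<in> borel_measurable borel" for c
    using measurable_compose[OF _ borel_measurable_group_mult[OF bil, of s], of "\<lambda>x. (x, c)" borel] by simp
  have dil: "dilation s m r \<in> borel_measurable borel" for r
  proof (rule linear_borel_measurable)
    show "linear (dilation s m r)"
      unfolding dilation_def[abs_def]
      by (intro linear_compose_sum linear_compose_scale_right ballI linear_proj)
  qed
  note [measurable] = gm dil
  have U [measurable]: "U N \<in> borel_measurable S" for N
    unfolding U_def[abs_def] by measurable
  have law: "distr (group_convolution br s (convolution_power br s \<mu> N) (return borel (- (real N *\<^sub>R X))))
      borel (dilation s m (1 / sqrt (real N))) = distr S borel (U N)" for N
    by (simp add: group_convolution_return[OF bil] cp distr_distr comp_def U_def[abs_def])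
  have "bounded (range \<phi>)"
    unfolding bounded_iff using \<phi> by (intro exI[of _ 1]) auto
  then have "(\<lambda>N. \<integral>x. \<phi> x \<partial>distr S borel (U N)) \<longlonglongrightarrow> (\<integral>x. \<phi> x \<partial>\<nu>)"
    using limit cont unfolding weakly_converges_to_def law by blast
  then have lim: "(\<lambda>N. \<integral>\<omega>. \<phi> (U N \<omega>) \<partial>S) \<longlonglongrightarrow> (\<integral>x. \<phi> x \<partial>\<nu>)"
    by (simp add: integral_distr)
  obtain B where B: "0 \<le> B" "\<And>h v. 0 \<le> h \<Longrightarrow> h \<le> 1 \<Longrightarrow> norm v \<le> R \<Longrightarrow> \<bar>remainder h v\<bar> \<le> B"
    using remainder_bounded by blast
  define E where "E N = {\<omega> \<in> space S. (\<Sum>k<N. (\<Sum>i<k. f1 (\<omega> i))\<^sup>2 / 2 * f0 (\<omega> k)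
      + (\<Sum>i<k. f1 (\<omega> i)) * word10 f0 f1 f2 (\<omega> k) + word110 f0 f1 f2 f3 (\<omega> k)) < - (\<eta> / 2) * (real N)\<^sup>2}" for N
  note mom = finite_moments[OF \<mu> moments]
  have [measurable]: "f0 \<in> borel_measurable \<mu>" "f1 \<in> borel_measurable \<mu>"
      "word10 f0 f1 f2 \<in> borel_measurable \<mu>" "word110 f0 f1 f2 f3 \<in> borel_measurable \<mu>"
    using mom by (simp_all add: finite_moment_def)
  have [measurable]: "E N \<in> sets S" for N unfolding E_def by measurable
  have prob0: "(\<lambda>N. prob (E N)) \<longlonglongrightarrow> 0"
    unfolding E_def using mom mean \<open>0 < \<eta>\<close>
    by (intro walk_functional_lower_bound) (simp_all add: finite_moment_2_iff finite_moment_def)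
  \<comment> \<open>Beyond \<open>N0\<close> the contribution \<open>B / sqrt N\<close> of the remainder is less than \<open>\<eta> / 2\<close>.\<close>
  obtain N0 where N0: "(2 * B / \<eta>)\<^sup>2 < real N0" using reals_Archimedean2 by blast
  have bad: "\<omega> \<in> E N" if \<omega>: "\<omega> \<in> space S" and N: "max 1 N0 \<le> N" and pos: "0 < \<phi> (U N \<omega>)" for N \<omega>
  proof -
    define r where "r = sqrt (real N)"
    have r: "1 \<le> r" "r\<^sup>2 = real N" using N by (simp_all add: r_def)
    have "2 * B / \<eta> < r"
    proof (rule power2_less_imp_less)
      show "(2 * B / \<eta>)\<^sup>2 < r\<^sup>2" using N0 N r by simp
    qed (use r in simp)
    then have small: "1 / r * B < \<eta> / 2"
      using r \<open>0 < \<eta>\<close> by (simp add: field_simps)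
    define v where "v = U N \<omega>"
    have v: "limit_form v < - \<eta>" "norm v \<le> R"
      using pos by (auto simp: \<phi>_def v_def[symmetric] min_def max_def split: if_splits)
    have "\<bar>remainder (1 / r) v\<bar> \<le> B" using B(2)[of "1 / r" v] r v by simp
    then have "1 / r * remainder (1 / r) v \<le> 1 / r * B"
      using r by (intro mult_left_mono) auto
    then have lt: "limit_form v + 1 / r * remainder (1 / r) v < - (\<eta> / 2)"
      using small v by linarith
    let ?T = "group_mult br s (P N \<omega>) (- (real N *\<^sub>R X))"
    have "word110 f0 f1 f2 f3 (P N \<omega>) = word110 f0 f1 f2 f3 ?T + r\<^sup>2 * (f1 ?T)\<^sup>2 / 2"
      unfolding word110_recentered r by simp
    also have "\<dots> = r ^ 4 * (limit_form v + 1 / r * remainder (1 / r) v)"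
      using word110_rescaled[of r ?T] r by (simp add: v_def U_def r_def)
    also have "\<dots> < r ^ 4 * - (\<eta> / 2)"
      using lt r by (intro mult_strict_left_mono) auto
    also have "r ^ 4 = (real N)\<^sup>2"
      by (simp flip: r(2) power_mult)
    finally show ?thesis
      using \<omega> unfolding E_def P_def partial_product_filiform[OF coords step3] by (simp add: mult.commute)
  qed
  have "(\<lambda>N. \<integral>\<omega>. \<phi> (U N \<omega>) \<partial>S) \<longlonglongrightarrow> 0"
  proof (rule tendsto_sandwich[OF _ _ tendsto_const prob0])
    show "\<forall>\<^sub>F N in sequentially. (\<integral>\<omega>. \<phi> (U N \<omega>) \<partial>S) \<le> prob (E N)"
    proof (rule eventually_sequentiallyI)
      fix N assume N: "max 1 N0 \<le> N"
      have "(\<integral>\<omega>. \<phi> (U N \<omega>) \<partial>S) \<le> (\<integral>\<omega>. indicator (E N) \<omega> \<partial>S)"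
      proof (rule integral_mono)
        show "integrable S (\<lambda>\<omega>. \<phi> (U N \<omega>))"
          by (rule integrable_const_bound[of _ 1]) (use \<phi> in auto)
        show "\<phi> (U N \<omega>) \<le> indicator (E N) \<omega>" if "\<omega> \<in> space S" for \<omega>
          using bad[OF that N] \<phi>[of "U N \<omega>"] by (cases "\<phi> (U N \<omega>) = 0") (auto simp: indicator_def)
        show "integrable S (indicator (E N) :: (nat \<Rightarrow> 'a) \<Rightarrow> real)"
          by (rule integrable_const_bound[of _ 1]) auto
      qed
      then show "(\<integral>\<omega>. \<phi> (U N \<omega>) \<partial>S) \<le> prob (E N)" by simp
    qed
  qed (simp add: \<phi>)
  then have "(\<integral>x. \<phi> x \<partial>\<nu>) = 0"
    using lim LIMSEQ_unique by blast
  then have "\<phi> u = 0"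
    using support_zero_of_integral_zero[OF \<nu> cont _ _ _ u] \<phi> by blast
  then show False
    using \<open>0 < \<eta>\<close> by (simp add: \<phi>_def \<eta>_def R_def)
qed

end

theorem theorem1p2:
  fixes br :: "'a::euclidean_space \<Rightarrow> 'a \<Rightarrow> 'a"
    and s :: nat
    and ab :: "'a \<Rightarrow> 'b::euclidean_space"
    and \<mu> \<nu> :: "'a measure"
    and m :: "nat \<Rightarrow> 'a set"
    and X :: 'a
  assumes "free_nilpotent_lie_algebra br s" and "3 \<le> s"
    and "abelianization_map br ab"
    and "prob_space \<mu>" and "sets \<mu> = sets borel"
    and noncentered: "(\<integral>y. y \<partial>(distr \<mu> borel ab)) \<noteq> 0"
    and mean: "ab X = (\<integral>y. y \<partial>(distr \<mu> borel ab))" and "X \<in> m 1"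
    and "weight_decomposition br s X m"
    and "finite_weighted_second_moment s m \<mu>"
    and nondegenerate: "\<And>A. affine A \<Longrightarrow> measure_support (distr \<mu> borel ab) \<subseteq> A \<Longrightarrow> A = UNIV"
    and "prob_space \<nu>" and "sets \<nu> = sets borel"
    and limit: "weakly_converges_to
      (\<lambda>N. distr (group_convolution br s (convolution_power br s \<mu> N) (return borel (- (real N *\<^sub>R X))))
                 borel (dilation s m (1 / sqrt (real N)))) \<nu>"
  shows "0 \<notin> interior (measure_support \<nu>)"
proof
  assume "0 \<in> interior (measure_support \<nu>)"
  have "lie_algebra br" "lower_central br s = {0}"
    using assms(1) by (auto simp: free_nilpotent_lie_algebra_def)
  have "X \<notin> bracket_span br UNIV UNIV"
  proof
    assume "X \<in> bracket_span br UNIV UNIV"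
    then have "ab X = 0" using assms(3) unfolding abelianization_map_def by blast
    then show False using noncentered mean by simp
  qed
  then obtain f0 f1 f2 f3 Y where f: "filiform_coordinates br f0 f1 f2 f3"
    "f0 X = 1" "f1 X = 0" "f2 X = 0" "f3 X = 0" "f1 Y = 1"
    using free_nilpotent_filiform_coordinates[OF assms(1,2)] by metis
  interpret filiform_limit br s X m f0 f1 f2 f3 Y
    by unfold_locales (use assms f \<open>lie_algebra br\<close> \<open>lower_central br s = {0}\<close> in \<open>auto simp: lie_algebra_def\<close>)
  have "(\<integral>x. f0 x \<partial>\<mu>) = f0 X" "(\<integral>x. f1 x \<partial>\<mu>) = f1 X"
    using integral_abelian_functional[OF assms(3,5) noncentered mean] lin by auto
  then have "limit_form u \<ge> 0" if "u \<in> measure_support \<nu>" for u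
    using limit_form_nonneg_on_support[OF assms(4,5,10) _ _ assms(12,13) limit that] X by simp
  moreover obtain u where "u \<in> interior (measure_support \<nu>)" "limit_form u < 0"
    using limit_form_negative_near_0[OF open_interior \<open>0 \<in> interior (measure_support \<nu>)\<close>] .
  ultimately show False
    using interior_subset by fastforce
qed

end
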